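(* Let $(\mathbb{R}^d,\cdot,X,K)$ be a sub-Finsler nilpotent group. The isoperimetric profile $I_K$ is non-decreasing, i.e. $I_K(w)\le I_K(v)$ whenever $0<w\le v$.
   Context: Setting. A nilpotent group is a connected, simply connected Lie group $G$ whose Lie algebra $\mathfrak{g}$ is nilpotent. With $\mathfrak{g}_0=\mathfrak{g}$, $\mathfrak{g}_{i+1}=[\mathfrak{g},\mathfrak{g}_i]$ and $r$ the step ($\mathfrak{g}_r=0\ne\mathfrak{g}_{r-1}$), fix a Malcev basis $\{Y_1,\dots,Y_d\}$ of $\mathfrak{g}$, i.e. a basis such that each $\mathrm{span}\{Y_{d-n+1},\dots,Y_d\}$, $1\le n\le d$, is an ideal and each $\mathfrak{g}_i$, $0\le i\le r-1$, is one of these ideals. Identify $G$ with $(\mathbb{R}^d,\cdot)$ via $(x_1,\dots,x_d)\mapsto\exp(x_1Y_1+\dots+x_dY_d)$; the identity is $0$. The Lebesgue measure $|\cdot|$ of $\mathbb{R}^d$ is then a Haar measure of the group. $X=\{X_1,\dots,X_k\}$ is a system of linearly independent left-invariant vector fields. Put $\mathcal{H}^0=\mathrm{span}(X)$ and $\mathcal{H}^n=\mathcal{H}^{n-1}+[\mathcal{H}^{n-1},\mathcal{H}^0]$; $X$ is assumed to be Lie bracket generating, i.e. $\mathcal{H}^s(0)=\mathfrak{g}$ for some $s$. Vector fields tangent to $\mathcal{H}^0$ at every point are called horizontal. Fix a left-invariant Riemannian metric $g=\langle\cdot,\cdot\rangle$ for which $X$ is an orthonormal basis of $\mathcal{H}^0$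 and $\mathcal{H}^0$ is orthogonal to a chosen complementary subbundle $V$; $\operatorname{div}$ is the divergence with respect to $g$. $K\subset\mathcal{H}^0_0$ is a convex body (compact convex set) with $0$ in its interior (relative to $\mathcal{H}^0_0$), not necessarily symmetric. It defines the asymmetric norm $\|u\|_K=\inf\{\lambda\ge0:u\in\lambda K\}$ on $\mathcal{H}^0_0$, extended to $\mathcal{H}^0$ by left-invariance: $\|\sum_i a_iX_i(p)\|_K=\|\sum_i a_iX_i(0)\|_K$. The data $(\mathbb{R}^d,\cdot,X,K)$ is called a sub-Finsler nilpotent group. Perimeter. For a measurable set $E\subseteq\mathbb{R}^d$, $P_K(E)=\sup\{\int_E\operatorname{div}(U)\,dx\}$, the supremum being over compactly supported $C^1$ horizontal vector fields $U$ on $\mathbb{R}^d$ with $\sup_p\|U_p\|_K\le1$. $E$ is a finite perimeter set if $P_K(E)<+\infty$. Isoperimetric profile. For $v>0$, $I_K(v)=\inf\{P_K(E): E\subseteq\mathbb{R}^d \text{ is a finite perimeter set and } |E|=v\}$. *)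

theory Defs
  imports "HOL-Analysis.Analysis"
begin

subsection \<open>Differentiability classes and vector fields\<close>

text \<open>
  \<open>Ck n f\<close> is meant for finite-dimensional domains: there, continuity of all iterated directional
  derivatives is the usual \<open>C\<^sup>n\<close> condition.
\<close>

primrec Ck :: "nat \<Rightarrow> ('a::real_normed_vector \<Rightarrow> 'b::real_normed_vector) \<Rightarrow> bool" where
  "Ck 0 f \<longleftrightarrow> continuous_on UNIV f"
| "Ck (Suc n) f \<longleftrightarrow>
     f differentiable_on UNIV \<and> (\<forall>v. Ck n (\<lambda>x. frechet_derivative f (at x) v))"

definition smooth :: "('a::real_normed_vector \<Rightarrow> 'b::real_normed_vector) \<Rightarrow> bool" where
  "smooth f \<longleftrightarrow> (\<forall>n. Ck n f)"

text \<open>A vector field on \<open>\<real>\<^sup>d\<close> is a function \<open>real^'n \<Rightarrow> real^'n\<close>, with \<open>d = CARD('n)\<close>.\<close>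

definition vf_bracket ::
  "(real^'n \<Rightarrow> real^'n) \<Rightarrow> (real^'n \<Rightarrow> real^'n) \<Rightarrow> real^'n \<Rightarrow> real^'n" where
  "vf_bracket U W p =
     frechet_derivative W (at p) (U p) - frechet_derivative U (at p) (W p)"


subsection \<open>The Lie algebra of a Lie group structure on \<open>\<real>\<^sup>d\<close> with identity \<open>0\<close>\<close>

definition left_invariant ::
  "(real^'n \<Rightarrow> real^'n \<Rightarrow> real^'n) \<Rightarrow> (real^'n \<Rightarrow> real^'n) \<Rightarrow> bool" where
  "left_invariant mul U \<longleftrightarrow> (\<forall>p q. U (mul p q) = frechet_derivative (mul p) (at q) (U q))"

definition left_inv_field ::
  "(real^'n \<Rightarrow> real^'n \<Rightarrow> real^'n) \<Rightarrow> real^'n \<Rightarrow> real^'n \<Rightarrow> real^'n" where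
  "left_inv_field mul u p = frechet_derivative (mul p) (at 0) u"

text \<open>
  The Lie algebra is the tangent space at the identity, that is \<open>real^'n\<close> itself, a tangent vector
  being identified with the left-invariant vector field extending it.
\<close>

definition lie_bracket ::
  "(real^'n \<Rightarrow> real^'n \<Rightarrow> real^'n) \<Rightarrow> real^'n \<Rightarrow> real^'n \<Rightarrow> real^'n" where
  "lie_bracket mul u v = vf_bracket (left_inv_field mul u) (left_inv_field mul v) 0"

definition lie_ideal ::
  "(real^'n \<Rightarrow> real^'n \<Rightarrow> real^'n) \<Rightarrow> (real^'n) set \<Rightarrow> bool" where
  "lie_ideal mul I \<longleftrightarrow> subspace I \<and> (\<forall>u. \<forall>v\<in>I. lie_bracket mul u v \<in> I)"

primrec lower_central ::
  "(real^'n \<Rightarrow> real^'n \<Rightarrow> real^'n) \<Rightarrow> nat \<Rightarrow> (real^'n) set" where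
  "lower_central mul 0 = UNIV"
| "lower_central mul (Suc i) = span {lie_bracket mul u v | u v. v \<in> lower_central mul i}"

text \<open>
  The Malcev basis \<open>Y\<^sub>1, \<dots>, Y\<^sub>d\<close> is the standard basis, ordered by the linear order of the index
  type; this is the span of the last basis vectors, from index \<open>i\<close> on.
\<close>

definition tail_span :: "'n \<Rightarrow> (real^'n::{finite,linorder}) set" where
  "tail_span i = span {axis j 1 | j. i \<le> j}"

text \<open>
  A connected, simply connected nilpotent Lie group of step \<open>r\<close>, read in the coordinates
  \<open>(x\<^sub>1, \<dots>, x\<^sub>d) \<mapsto> exp (x\<^sub>1 Y\<^sub>1 + \<dots> + x\<^sub>d Y\<^sub>d)\<close> given by a Malcev basis. In these coordinates the
  exponential map is the identity, i.e. the one-parameter subgroup with initial velocity \<open>x\<close> is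
  \<open>t \<mapsto> t x\<close>; this is the content of \<open>exp_coords\<close>.
\<close>

locale nilpotent_group =
  fixes mul :: "real^'n::{finite,linorder} \<Rightarrow> real^'n::{finite,linorder} \<Rightarrow> real^'n::{finite,linorder}"
    and inv :: "real^'n::{finite,linorder} \<Rightarrow> real^'n::{finite,linorder}"
    and r :: nat
  assumes group: "Groups.group mul 0 inv"
    and smooth_mul: "smooth (\<lambda>z. mul (fst z) (snd z))"
    and smooth_inv: "smooth inv"
    and exp_coords: "\<And>x s t. mul (s *\<^sub>R x) (t *\<^sub>R x) = (s + t) *\<^sub>R x"
    and step_pos: "1 \<le> r"
    and step_trivial: "lower_central mul r = {0}"
    and step_nontrivial: "lower_central mul (r - 1) \<noteq> {0}"
    and malcev_ideal: "\<And>i. lie_ideal mul (tail_span i)"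
    and malcev_central: "\<And>i. i < r \<Longrightarrow> \<exists>j. lower_central mul i = tail_span j"


subsection \<open>Horizontal structure, metric and asymmetric norm\<close>

text \<open>The system \<open>X\<^sub>1, \<dots>, X\<^sub>k\<close> is \<open>X 0, \<dots>, X (k - 1)\<close>; other values of \<open>X\<close> are irrelevant.\<close>

definition lin_indep_fields :: "nat \<Rightarrow> (nat \<Rightarrow> real^'n \<Rightarrow> real^'n) \<Rightarrow> bool" where
  "lin_indep_fields k X \<longleftrightarrow>
     (\<forall>c::nat \<Rightarrow> real. (\<forall>p. (\<Sum>i<k. c i *\<^sub>R X i p) = 0) \<longrightarrow> (\<forall>i<k. c i = 0))"

definition horizontal :: "nat \<Rightarrow> (nat \<Rightarrow> real^'n \<Rightarrow> real^'n) \<Rightarrow> real^'n \<Rightarrow> (real^'n) set" where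
  "horizontal k X p = span {X i p | i. i < k}"

text \<open>The spaces \<open>\<H>\<^sup>n\<close>, as subspaces of the Lie algebra.\<close>

primrec horizontal_filtration ::
  "(real^'n \<Rightarrow> real^'n \<Rightarrow> real^'n) \<Rightarrow> nat \<Rightarrow> (nat \<Rightarrow> real^'n \<Rightarrow> real^'n) \<Rightarrow> nat \<Rightarrow> (real^'n) set" where
  "horizontal_filtration mul k X 0 = horizontal k X 0"
| "horizontal_filtration mul k X (Suc n) =
     span (horizontal_filtration mul k X n \<union>
       {lie_bracket mul u v | u v. u \<in> horizontal_filtration mul k X n \<and> v \<in> horizontal k X 0})"

definition bracket_generating ::
  "(real^'n \<Rightarrow> real^'n \<Rightarrow> real^'n) \<Rightarrow> nat \<Rightarrow> (nat \<Rightarrow> real^'n \<Rightarrow> real^'n) \<Rightarrow> bool" where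
  "bracket_generating mul k X \<longleftrightarrow> (\<exists>s. horizontal_filtration mul k X s = UNIV)"

definition riemannian_metric :: "(real^'n \<Rightarrow> real^'n \<Rightarrow> real^'n \<Rightarrow> real) \<Rightarrow> bool" where
  "riemannian_metric g \<longleftrightarrow>
     (\<forall>p. bilinear (g p)) \<and>
     (\<forall>p u v. g p u v = g p v u) \<and>
     (\<forall>p u. u \<noteq> 0 \<longrightarrow> 0 < g p u u) \<and>
     (\<forall>u v. smooth (\<lambda>p. g p u v))"

definition left_invariant_metric ::
  "(real^'n \<Rightarrow> real^'n \<Rightarrow> real^'n) \<Rightarrow> (real^'n \<Rightarrow> real^'n \<Rightarrow> real^'n \<Rightarrow> real) \<Rightarrow> bool" where
  "left_invariant_metric mul g \<longleftrightarrow>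
     (\<forall>p q u v. g (mul p q) (frechet_derivative (mul p) (at q) u)
                            (frechet_derivative (mul p) (at q) v) = g q u v)"

text \<open>Riemannian divergence, \<open>(det g)\<^sup>-\<^sup>1\<^sup>/\<^sup>2 \<Sum>\<^sub>i \<partial>\<^sub>i ((det g)\<^sup>1\<^sup>/\<^sup>2 U\<^sub>i)\<close> in the global chart.\<close>

definition volume_density :: "(real^'n \<Rightarrow> real^'n \<Rightarrow> real^'n \<Rightarrow> real) \<Rightarrow> real^'n \<Rightarrow> real" where
  "volume_density g p = sqrt (det (\<chi> i j. g p (axis i 1) (axis j 1) :: real^'n^'n))"

definition divergence ::
  "(real^'n \<Rightarrow> real^'n \<Rightarrow> real^'n \<Rightarrow> real) \<Rightarrow> (real^'n \<Rightarrow> real^'n) \<Rightarrow> real^'n \<Rightarrow> real" where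
  "divergence g U p =
     (\<Sum>i\<in>UNIV. frechet_derivative (\<lambda>q. volume_density g q * U q $ i) (at p) (axis i 1))
       / volume_density g p"

definition asym_norm :: "'a::real_vector set \<Rightarrow> 'a \<Rightarrow> real" where
  "asym_norm K u = Inf {l. 0 \<le> l \<and> u \<in> (\<lambda>x. l *\<^sub>R x) ` K}"

text \<open>
  Extension by left-invariance: \<open>\<parallel>\<Sum>\<^sub>i a\<^sub>i X\<^sub>i(p)\<parallel>\<^sub>K = \<parallel>\<Sum>\<^sub>i a\<^sub>i X\<^sub>i(0)\<parallel>\<^sub>K\<close>. For linearly independent
  left-invariant \<open>X\<^sub>i\<close> the coefficients \<open>a i\<close> with \<open>i < k\<close> of a horizontal vector are unique; the
  value is meaningless on non-horizontal vectors.
\<close>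

definition asym_norm_at ::
  "nat \<Rightarrow> (nat \<Rightarrow> real^'n \<Rightarrow> real^'n) \<Rightarrow> (real^'n) set \<Rightarrow> real^'n \<Rightarrow> real^'n \<Rightarrow> real" where
  "asym_norm_at k X K p v =
     (let a = (SOME a. v = (\<Sum>i<k. a i *\<^sub>R X i p)) in asym_norm K (\<Sum>i<k. a i *\<^sub>R X i 0))"

locale sub_finsler_nilpotent_group = nilpotent_group mul inv r
  for mul :: "real^'n::{finite,linorder} \<Rightarrow> real^'n::{finite,linorder} \<Rightarrow> real^'n::{finite,linorder}"
    and inv :: "real^'n::{finite,linorder} \<Rightarrow> real^'n::{finite,linorder}"
    and r :: nat +
  fixes k :: nat
    and X :: "nat \<Rightarrow> real^'n::{finite,linorder} \<Rightarrow> real^'n::{finite,linorder}"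
    and V :: "real^'n::{finite,linorder} \<Rightarrow> (real^'n::{finite,linorder}) set"
    and g :: "real^'n::{finite,linorder} \<Rightarrow> real^'n::{finite,linorder} \<Rightarrow> real^'n::{finite,linorder} \<Rightarrow> real"
    and K :: "(real^'n::{finite,linorder}) set"
  assumes X_left_invariant: "\<And>i. i < k \<Longrightarrow> left_invariant mul (X i)"
    and X_indep: "lin_indep_fields k X"
    and X_generating: "bracket_generating mul k X"
    and metric: "riemannian_metric g"
    and metric_left_invariant: "left_invariant_metric mul g"
    and X_orthonormal:
      "\<And>p i j. i < k \<Longrightarrow> j < k \<Longrightarrow> g p (X i p) (X j p) = (if i = j then 1 else 0)"
    and V_subspace: "\<And>p. subspace (V p)"
    and V_inter: "\<And>p. horizontal k X p \<inter> V p = {0}"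
    and V_sum: "\<And>p. span (horizontal k X p \<union> V p) = UNIV"
    and V_orthogonal: "\<And>p u v. u \<in> horizontal k X p \<Longrightarrow> v \<in> V p \<Longrightarrow> g p u v = 0"
    and K_subset: "K \<subseteq> horizontal k X 0"
    and K_compact: "compact K"
    and K_convex: "convex K"
    and K_interior: "0 \<in> (top_of_set (horizontal k X 0)) interior_of K"


subsection \<open>Perimeter and isoperimetric profile\<close>

definition test_field ::
  "nat \<Rightarrow> (nat \<Rightarrow> real^'n \<Rightarrow> real^'n) \<Rightarrow> (real^'n) set \<Rightarrow> (real^'n \<Rightarrow> real^'n) \<Rightarrow> bool" where
  "test_field k X K U \<longleftrightarrow>
     Ck 1 U \<and> compact (closure {p. U p \<noteq> 0}) \<and>
     (\<forall>p. U p \<in> horizontal k X p) \<and> (\<forall>p. asym_norm_at k X K p (U p) \<le> 1)"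

definition perimeter ::
  "nat \<Rightarrow> (nat \<Rightarrow> real^'n \<Rightarrow> real^'n) \<Rightarrow> (real^'n \<Rightarrow> real^'n \<Rightarrow> real^'n \<Rightarrow> real) \<Rightarrow>
     (real^'n) set \<Rightarrow> (real^'n) set \<Rightarrow> ereal" where
  "perimeter k X g K E =
     Sup {ereal (LINT x:E|lebesgue. divergence g U x) | U. test_field k X K U}"

definition finite_perimeter ::
  "nat \<Rightarrow> (nat \<Rightarrow> real^'n \<Rightarrow> real^'n) \<Rightarrow> (real^'n \<Rightarrow> real^'n \<Rightarrow> real^'n \<Rightarrow> real) \<Rightarrow>
     (real^'n) set \<Rightarrow> (real^'n) set \<Rightarrow> bool" where
  "finite_perimeter k X g K E \<longleftrightarrow> E \<in> sets lebesgue \<and> perimeter k X g K E < \<infinity>"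

definition isoperimetric_profile ::
  "nat \<Rightarrow> (nat \<Rightarrow> real^'n \<Rightarrow> real^'n) \<Rightarrow> (real^'n \<Rightarrow> real^'n \<Rightarrow> real^'n \<Rightarrow> real) \<Rightarrow>
     (real^'n) set \<Rightarrow> real \<Rightarrow> ereal" where
  "isoperimetric_profile k X g K v =
     Inf {perimeter k X g K E | E. finite_perimeter k X g K E \<and> emeasure lebesgue E = ennreal v}"

end

theory Submission
  imports Defs
begin

text \<open>
  Intersecting with a half-space does not increase the perimeter if the half-space is calibrated, and the
  half-spaces \<open>{\<lambda> < t}\<close> cut out by the first Malcev coordinate \<open>\<lambda>\<close> are. Indeed \<open>\<lambda>\<close> is a homomorphism from the
  group to the real line. Hence, if a horizontal field is the translate of \<open>u \<in> K\<close> at a point, its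
  \<open>\<lambda>\<close>-component there is at most \<open>c = max \<lambda>\<close> over \<open>K\<close>; and the left-invariant field \<open>N\<close> through a maximiser has
  constant \<open>\<lambda>\<close>-component \<open>c\<close> and no divergence. Given a test field \<open>U\<close>, interpolating between \<open>U\<close> on \<open>{\<lambda> < t}\<close> and \<open>N\<close> on
  the complement, in a thin layer and with a cutoff at infinity, gives test fields for \<open>E\<close> whose divergence is
  almost bounded below by that of \<open>U\<close> restricted to \<open>{\<lambda> < t}\<close> (\<open>truncated_test_field\<close>). So the perimeter of
  \<open>E \<inter> {\<lambda> < t}\<close> is at most that of \<open>E\<close> (\<open>perimeter_half_space_le\<close>). As \<open>t\<close> varies, the volume of \<open>E \<inter> {\<lambda> < t}\<close> takes
  every value between \<open>0\<close> and \<open>|E|\<close> (\<open>half_space_of_measure\<close>), so a set of volume \<open>v\<close> can be cut down to volume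
  \<open>w \<le> v\<close> at no cost in perimeter.

  That \<open>\<lambda>\<close> is a homomorphism, that left-invariant fields are divergence free, and that the Riemannian volume
  is a constant multiple of Lebesgue measure all come from one fact: the differentials of left and
  right translations are unitriangular in Malcev coordinates (\<open>unitriangular_Dmul_left\<close>,
  \<open>unitriangular_Dmul_right\<close>). On the Lie algebra the corresponding statement is that the maps \<open>ad x\<close> are strictly
  triangular, by the ideal property of the Malcev flag and nilpotency. It passes to the group in two
  steps, each a linear differential equation along a ray \<open>t x\<close>: the equation \<open>y' = [x, y]\<close> for the adjoint action,
  and then \<open>c' = - [x, c] + v\<close> for the differential of the exponential map, read in left translation.
\<close>

section \<open>Continuously differentiable functions\<close>

lemma Ck_1_I:
  assumes "\<And>x. (f has_derivative f' x) (at x)" and "\<And>v. continuous_on UNIV (\<lambda>x. f' x v)"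
  shows "Ck 1 f"
proof -
  have "frechet_derivative f (at x) = f' x" for x
    using frechet_derivative_at[OF assms(1)] by simp
  moreover have "f differentiable_on UNIV"
    using assms(1) by (auto simp: differentiable_on_def differentiable_def)
  ultimately show ?thesis using assms(2) by simp
qed

lemma Ck_1_has_derivative:
  assumes "Ck 1 f"
  shows "(f has_derivative frechet_derivative f (at x)) (at x)"
  using assms frechet_derivative_works[of f "at x"] by (auto simp: differentiable_on_def)

lemma Ck_1_linear_derivative: "Ck 1 f \<Longrightarrow> linear (frechet_derivative f (at x))"
  using Ck_1_has_derivative has_derivative_linear by blast

text \<open>
  Expanding the direction in a basis turns continuity of each directional derivative into joint
  continuity in the point and the direction. This is where finite dimension of the domain enters, and
  it is what makes \<^term>\<open>Ck 1\<close> stable under composition.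
\<close>

lemma Ck_1_continuous_derivative:
  fixes f :: "'a::euclidean_space \<Rightarrow> 'b::real_normed_vector"
  assumes "Ck 1 f" "continuous_on S h" "continuous_on S k"
  shows "continuous_on S (\<lambda>z. frechet_derivative f (at (h z)) (k z))"
proof -
  have eq: "frechet_derivative f (at y) w = (\<Sum>b\<in>Basis. (w \<bullet> b) *\<^sub>R frechet_derivative f (at y) b)" for y w
  proof -
    have "frechet_derivative f (at y) w = frechet_derivative f (at y) (\<Sum>b\<in>Basis. (w \<bullet> b) *\<^sub>R b)"
      by (simp add: euclidean_representation)
    then show ?thesis
      using Ck_1_linear_derivative[OF assms(1), of y] by (simp add: linear_sum linear_scale)
  qed
  have "continuous_on S (\<lambda>z. frechet_derivative f (at (h z)) b)" for b
    using assms(1,2) continuous_on_compose2[of UNIV "\<lambda>x. frechet_derivative f (at x) b" S h] by auto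
  then have "continuous_on S (\<lambda>z. \<Sum>b\<in>Basis. (k z \<bullet> b) *\<^sub>R frechet_derivative f (at (h z)) b)"
    using assms(3) by (intro continuous_intros)
  then show ?thesis by (subst eq)
qed

lemma Ck_1_continuous: "Ck 1 f \<Longrightarrow> continuous_on S f"
  by (meson Ck_1_has_derivative continuous_at_imp_continuous_on has_derivative_continuous)

lemma frechet_derivative_eq: "(f has_derivative f') (at x) \<Longrightarrow> frechet_derivative f (at x) = f'"
  by (metis frechet_derivative_at)

lemma Ck_1_compose:
  fixes f :: "'b::euclidean_space \<Rightarrow> 'c::real_normed_vector" and g :: "'a::real_normed_vector \<Rightarrow> 'b"
  assumes f: "Ck 1 f" and g: "Ck 1 g"
  shows "Ck 1 (\<lambda>x. f (g x))"
proof (rule Ck_1_I)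
  show "((\<lambda>x. f (g x)) has_derivative
     (\<lambda>v. frechet_derivative f (at (g x)) (frechet_derivative g (at x) v))) (at x)" for x
    using has_derivative_compose[OF Ck_1_has_derivative[OF g] Ck_1_has_derivative[OF f]] .
  show "continuous_on UNIV (\<lambda>x. frechet_derivative f (at (g x)) (frechet_derivative g (at x) v))" for v
    using g by (intro Ck_1_continuous_derivative[OF f] Ck_1_continuous[OF g]) simp
qed

lemma Ck_1_bounded_linear: "bounded_linear f \<Longrightarrow> Ck 1 f"
  by (rule Ck_1_I[where f' = "\<lambda>_. f"]) (auto intro: bounded_linear_imp_has_derivative)

lemma Ck_1_const: "Ck 1 (\<lambda>_. c)"
  by (rule Ck_1_I[where f' = "\<lambda>_ _. 0"]) auto

lemma Ck_1_add:
  assumes "Ck 1 f" "Ck 1 g"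
  shows "Ck 1 (\<lambda>x. f x + g x)"
proof (rule Ck_1_I)
  show "((\<lambda>x. f x + g x) has_derivative
     (\<lambda>v. frechet_derivative f (at x) v + frechet_derivative g (at x) v)) (at x)" for x
    by (intro has_derivative_add Ck_1_has_derivative assms)
  show "continuous_on UNIV (\<lambda>x. frechet_derivative f (at x) v + frechet_derivative g (at x) v)" for v
    by (intro continuous_intros) (use assms in auto)
qed

lemma has_derivative_scaleR_Ck_1:
  fixes f :: "'a::real_normed_vector \<Rightarrow> real"
  assumes "Ck 1 f" "Ck 1 g"
  shows "((\<lambda>x. f x *\<^sub>R g x) has_derivative
     (\<lambda>v. f x *\<^sub>R frechet_derivative g (at x) v + frechet_derivative f (at x) v *\<^sub>R g x)) (at x)"
  using has_derivative_scaleR[OF Ck_1_has_derivative[OF assms(1)] Ck_1_has_derivative[OF assms(2)]] .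

lemma Ck_1_scaleR:
  fixes f :: "'a::real_normed_vector \<Rightarrow> real"
  assumes "Ck 1 f" "Ck 1 g"
  shows "Ck 1 (\<lambda>x. f x *\<^sub>R g x)"
proof (rule Ck_1_I[OF has_derivative_scaleR_Ck_1[OF assms]])
  fix v
  show "continuous_on UNIV (\<lambda>x. f x *\<^sub>R frechet_derivative g (at x) v + frechet_derivative f (at x) v *\<^sub>R g x)"
    using assms Ck_1_continuous[OF assms(1)] Ck_1_continuous[OF assms(2)]
    by (auto intro!: continuous_on_add continuous_on_scaleR)
qed

lemma Ck_1_Pair:
  assumes "Ck 1 f" "Ck 1 g"
  shows "Ck 1 (\<lambda>x. (f x, g x))"
proof (rule Ck_1_I)
  show "((\<lambda>x. (f x, g x)) has_derivative (\<lambda>v. (frechet_derivative f (at x) v, frechet_derivative g (at x) v))) (at x)" for x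
    by (intro has_derivative_Pair Ck_1_has_derivative assms)
  show "continuous_on UNIV (\<lambda>x. (frechet_derivative f (at x) v, frechet_derivative g (at x) v))" for v
    by (intro continuous_intros) (use assms in auto)
qed

lemma Ck_1_real:
  fixes f :: "real \<Rightarrow> real"
  assumes "\<And>x. (f has_real_derivative f' x) (at x)" and "continuous_on UNIV f'"
  shows "Ck 1 f"
proof (rule Ck_1_I)
  show "(f has_derivative (\<lambda>v. f' x * v)) (at x)" for x
    using assms(1)[of x] by (simp add: has_field_derivative_def)
  show "continuous_on UNIV (\<lambda>x. f' x * v)" for v
    by (intro continuous_intros assms)
qed

lemma linear_expand_vec:
  assumes "linear F"
  shows "F u = (\<Sum>j\<in>UNIV. u $ j *\<^sub>R F (axis j 1))"
proof -
  have "(\<Sum>j\<in>UNIV. u $ j *\<^sub>R axis j 1) = u"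
    using basis_expansion[of u] by (simp add: scalar_mult_eq_scaleR)
  then show ?thesis
    using linear_sum[OF assms, of "\<lambda>j. u $ j *\<^sub>R axis j 1" UNIV] by (simp add: linear_scale[OF assms])
qed

definition euclidean_divergence :: "(real^'n \<Rightarrow> real^'n) \<Rightarrow> real^'n \<Rightarrow> real" where
  "euclidean_divergence U p = (\<Sum>i\<in>UNIV. frechet_derivative U (at p) (axis i 1) $ i)"

lemma euclidean_divergence_add:
  assumes "Ck 1 U" "Ck 1 W"
  shows "euclidean_divergence (\<lambda>p. U p + W p) p = euclidean_divergence U p + euclidean_divergence W p"
  using frechet_derivative_eq[OF has_derivative_add[OF Ck_1_has_derivative[OF assms(1)] Ck_1_has_derivative[OF assms(2)], of p]]
  by (simp add: euclidean_divergence_def sum.distrib)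

lemma euclidean_divergence_scaleR:
  assumes "Ck 1 f" "Ck 1 U"
  shows "euclidean_divergence (\<lambda>p. f p *\<^sub>R U p) p =
    f p * euclidean_divergence U p + frechet_derivative f (at p) (U p)"
  using frechet_derivative_eq[OF has_derivative_scaleR_Ck_1[OF assms, of p]]
    linear_expand_vec[OF Ck_1_linear_derivative[OF assms(1)], of p "U p"]
  by (simp add: euclidean_divergence_def sum.distrib sum_distrib_left mult.commute)

lemma continuous_euclidean_divergence:
  assumes "Ck 1 U"
  shows "continuous_on UNIV (euclidean_divergence U)"
  unfolding euclidean_divergence_def[abs_def]
  by (intro continuous_on_sum continuous_on_component) (use assms in simp)

lemma euclidean_divergence_outside_support:
  assumes "p \<notin> closure {q. U q \<noteq> 0}"
  shows "euclidean_divergence U p = 0"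
proof -
  have "((\<lambda>_. 0) has_derivative (\<lambda>_. 0)) (at p)" by simp
  then have "(U has_derivative (\<lambda>_. 0)) (at p)"
  proof (rule has_derivative_transform_within_open)
    show "open (- closure {q. U q \<noteq> 0})" by auto
    show "p \<in> - closure {q. U q \<noteq> 0}" using assms by simp
    show "0 = U x" if "x \<in> - closure {q. U q \<noteq> 0}" for x
      using that closure_subset[of "{q. U q \<noteq> 0}"] by auto
  qed
  then show ?thesis by (simp add: euclidean_divergence_def frechet_derivative_eq)
qed

lemma integrable_compact_support:
  fixes f :: "real^'n \<Rightarrow> real"
  assumes "continuous_on UNIV f" "compact S" "\<And>x. x \<notin> S \<Longrightarrow> f x = 0"
  shows "integrable lebesgue f"
proof -
  have "integrable lborel (\<lambda>x. indicator S x *\<^sub>R f x)"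
    using assms by (intro borel_integrable_compact) (auto intro: continuous_on_subset)
  moreover have "(\<lambda>x. indicator S x *\<^sub>R f x) = f"
    using assms(3) by (auto simp: indicator_def fun_eq_iff)
  ultimately have "integrable lborel f" by simp
  then show ?thesis using integrable_completion[of f lborel] by (simp add: borel_measurable_integrable)
qed

section \<open>Cutoff functions\<close>

lemma has_real_derivative_max_0_square:
  "((\<lambda>x::real. (max 0 x)\<^sup>2) has_real_derivative 2 * max 0 x) (at x)"
proof -
  consider "x < 0" | "x = 0" | "0 < x" by linarith
  then show ?thesis
  proof cases
    case 1
    have "((\<lambda>_. 0) has_real_derivative 0) (at x)" by simp
    then have "((\<lambda>x::real. (max 0 x)\<^sup>2) has_real_derivative 0) (at x)"
      by (rule has_field_derivative_transform_within_open[where S = "{..<0}"]) (use 1 in auto)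
    then show ?thesis using 1 by simp
  next
    case 2
    have "((\<lambda>h::real. max 0 h) \<longlongrightarrow> max 0 0) (at 0)" by (intro tendsto_intros)
    then have "((\<lambda>h::real. max 0 h) \<longlongrightarrow> 0) (at 0)" by simp
    then have "((\<lambda>h::real. (max 0 h)\<^sup>2 / h) \<longlongrightarrow> 0) (at 0)"
      by (rule Lim_transform_eventually) (auto simp: eventually_at_filter max_def power2_eq_square)
    then show ?thesis using 2 by (simp add: has_field_derivative_iff)
  next
    case 3
    have "((\<lambda>x. x\<^sup>2) has_real_derivative 2 * x) (at x)"
      by (auto intro!: derivative_eq_intros)
    then have "((\<lambda>x::real. (max 0 x)\<^sup>2) has_real_derivative 2 * x) (at x)"
      by (rule has_field_derivative_transform_within_open[where S = "{0<..}"]) (use 3 in auto)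
    then show ?thesis using 3 by simp
  qed
qed

text \<open>
  With \<open>q x = (max 0 x)\<^sup>2\<close>, which is \<open>C\<^sup>1\<close>, the quotient \<open>q x / (q x + q (1 - x))\<close> rises from \<open>0\<close> to \<open>1\<close> on
  the unit interval; its denominator never vanishes because \<open>x\<close> and \<open>1 - x\<close> are not both \<open>\<le> 0\<close>.
\<close>

lemma C1_step_function:
  obtains s s' :: "real \<Rightarrow> real"
  where "\<And>x. (s has_real_derivative s' x) (at x)" "continuous_on UNIV s'" "\<And>x. 0 \<le> s' x"
    "\<And>x. 0 \<le> s x" "\<And>x. s x \<le> 1" "\<And>x. x \<le> 0 \<Longrightarrow> s x = 0" "\<And>x. x \<le> 0 \<Longrightarrow> s' x = 0"
    "\<And>x. 1 \<le> x \<Longrightarrow> s x = 1"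
proof
  let ?a = "\<lambda>x::real. (max 0 x)\<^sup>2" and ?b = "\<lambda>x::real. (max 0 (1 - x))\<^sup>2"
  let ?s = "\<lambda>x. ?a x / (?a x + ?b x)"
  let ?s' = "\<lambda>x. (2 * max 0 x * ?b x + ?a x * (2 * max 0 (1 - x))) / (?a x + ?b x)\<^sup>2"
  have pos: "?a x + ?b x > 0" for x
  proof (cases "x > 0")
    case True
    then have "0 < ?a x" by simp
    then show ?thesis by (intro add_pos_nonneg) simp_all
  next
    case False
    then have "0 < ?b x" by simp
    then show ?thesis by (intro add_nonneg_pos) simp_all
  qed
  have b: "(?b has_real_derivative - (2 * max 0 (1 - x))) (at x)" for x
    by (rule DERIV_chain'[OF _ has_real_derivative_max_0_square, of "\<lambda>x. 1 - x" "-1", simplified])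
       (auto intro!: derivative_eq_intros)
  have "(?s has_real_derivative
     ((2 * max 0 x) * (?a x + ?b x) - ?a x * (2 * max 0 x + - (2 * max 0 (1 - x)))) / ((?a x + ?b x) * (?a x + ?b x))) (at x)" for x
    by (intro DERIV_divide DERIV_add has_real_derivative_max_0_square b less_imp_neq[OF pos, symmetric])
  moreover have "((2 * max 0 x) * (?a x + ?b x) - ?a x * (2 * max 0 x + - (2 * max 0 (1 - x)))) / ((?a x + ?b x) * (?a x + ?b x)) = ?s' x" for x
    by (simp only: power2_eq_square[of "?a x + ?b x"]) (simp add: algebra_simps)
  ultimately show "(?s has_real_derivative ?s' x) (at x)" for x by simp
  show "continuous_on UNIV ?s'"
    by (intro continuous_intros) (use pos in \<open>auto simp: less_imp_neq[symmetric] dest: less_imp_neq\<close>)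
  show "0 \<le> ?s' x" for x by simp
  show "0 \<le> ?s x" for x by simp
  show "?s x \<le> 1" for x using pos[of x] by (intro divide_le_eq_1_pos[THEN iffD2]) simp_all
  show "?s x = 0" if "x \<le> 0" for x using that by simp
  show "?s' x = 0" if "x \<le> 0" for x using that by simp
  show "?s x = 1" if "1 \<le> x" for x
  proof -
    have "?b x = 0" using that by (simp add: max_def)
    moreover have "?a x \<noteq> 0" using that by simp
    ultimately show ?thesis by simp
  qed
qed

lemma C1_bump_function:
  obtains a a' :: "real \<Rightarrow> real" and M :: real
  where "\<And>x. (a has_real_derivative a' x) (at x)" "continuous_on UNIV a'" "\<And>x. \<bar>a' x\<bar> \<le> M"
    "\<And>x. 0 \<le> a x" "\<And>x. a x \<le> 1" "\<And>x. \<bar>x\<bar> \<le> 1 \<Longrightarrow> a x = 1" "\<And>x. 2 \<le> \<bar>x\<bar> \<Longrightarrow> a x = 0"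
proof -
  obtain s s' :: "real \<Rightarrow> real"
  where s: "\<And>x. (s has_real_derivative s' x) (at x)" "continuous_on UNIV s'" "\<And>x. 0 \<le> s' x"
    "\<And>x. 0 \<le> s x" "\<And>x. s x \<le> 1" "\<And>x. x \<le> 0 \<Longrightarrow> s x = 0" "\<And>x. x \<le> 0 \<Longrightarrow> s' x = 0"
    "\<And>x. 1 \<le> x \<Longrightarrow> s x = 1"
    using C1_step_function by blast
  define a where "a x = s (2 - x\<^sup>2)" for x
  define a' where "a' x = s' (2 - x\<^sup>2) * (- 2 * x)" for x
  have d: "(a has_real_derivative a' x) (at x)" for x
    unfolding a_def a'_def
    by (rule DERIV_chain'[OF _ s(1)]) (auto intro!: derivative_eq_intros)
  have c: "continuous_on UNIV a'"
    unfolding a'_def by (intro continuous_intros continuous_on_compose2[OF s(2)]) auto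
  have "compact (a' ` {-2..2})"
    by (intro compact_continuous_image) (use c in \<open>auto intro: continuous_on_subset\<close>)
  then obtain M where M: "\<And>x. x \<in> {-2..2} \<Longrightarrow> \<bar>a' x\<bar> \<le> M"
    unfolding real_norm_def[symmetric] using compact_imp_bounded[of "a' ` {-2..2}"] by (metis bounded_iff imageI)
  have sq: "2 \<le> x\<^sup>2" if "2 \<le> \<bar>x\<bar>" for x :: real
    using power_mono[OF that, of 2] by simp
  have "\<bar>a' x\<bar> \<le> M" for x
  proof (cases "x \<in> {-2..2}")
    case False
    then have "a' x = 0" using sq[of x] by (auto simp: a'_def s(7))
    moreover have "0 \<le> M" using M[of 0] by simp
    ultimately show ?thesis by simp
  qed (use M in auto)
  moreover have "a x = 1" if "\<bar>x\<bar> \<le> 1" for x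
    using that s(8)[of "2 - x\<^sup>2"] abs_square_le_1[of x] by (simp add: a_def)
  ultimately show ?thesis
    using that[of a a' M] d c sq s by (simp add: a_def)
qed

lemma C1_cutoff:
  fixes C :: "'a::euclidean_space set"
  assumes "compact C"
  obtains \<beta> :: "'a \<Rightarrow> real" and R
  where "Ck 1 \<beta>" "\<And>x. 0 \<le> \<beta> x" "\<And>x. \<beta> x \<le> 1" "\<And>x. x \<in> C \<Longrightarrow> \<beta> x = 1" "\<And>x. \<beta> x \<noteq> 0 \<Longrightarrow> norm x \<le> R"
proof -
  obtain s s' :: "real \<Rightarrow> real"
  where s: "\<And>x. (s has_real_derivative s' x) (at x)" "continuous_on UNIV s'" "\<And>x. 0 \<le> s' x"
    "\<And>x. 0 \<le> s x" "\<And>x. s x \<le> 1" "\<And>x. x \<le> 0 \<Longrightarrow> s x = 0" "\<And>x. x \<le> 0 \<Longrightarrow> s' x = 0"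
    "\<And>x. 1 \<le> x \<Longrightarrow> s x = 1"
    using C1_step_function by blast
  obtain r where r: "r > 0" "\<And>x. x \<in> C \<Longrightarrow> norm x \<le> r"
    using compact_imp_bounded[OF assms] by (auto simp: bounded_pos)
  define \<beta> where "\<beta> x = s (2 - (x \<bullet> x) / r\<^sup>2)" for x :: 'a
  have q: "Ck 1 (\<lambda>x::'a. 2 - (x \<bullet> x) / r\<^sup>2)"
  proof (rule Ck_1_I)
    show "((\<lambda>x. 2 - (x \<bullet> x) / r\<^sup>2) has_derivative (\<lambda>v. - (2 * (x \<bullet> v) / r\<^sup>2))) (at x)" for x :: 'a
      using r(1) by (auto intro!: derivative_eq_intros simp: inner_commute fun_eq_iff field_simps)
    show "continuous_on UNIV (\<lambda>x::'a. - (2 * (x \<bullet> v) / r\<^sup>2))" for v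
      using r(1) by (intro continuous_intros) auto
  qed
  show ?thesis
  proof
    show "Ck 1 \<beta>" unfolding \<beta>_def[abs_def]
      by (rule Ck_1_compose[OF Ck_1_real[OF s(1,2)] q])
    show "0 \<le> \<beta> x" "\<beta> x \<le> 1" for x using s by (simp_all add: \<beta>_def)
    show "\<beta> x = 1" if "x \<in> C" for x
    proof -
      have "x \<bullet> x \<le> r\<^sup>2" using r(2)[OF that] by (simp add: power2_norm_eq_inner[symmetric] power_mono)
      then show ?thesis using r(1) by (simp add: \<beta>_def s(8))
    qed
    show "norm x \<le> 2 * r" if "\<beta> x \<noteq> 0" for x
    proof (rule ccontr)
      assume "\<not> norm x \<le> 2 * r"
      then have "(2 * r)\<^sup>2 \<le> (norm x)\<^sup>2" using r(1) by (intro power_mono) simp_all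
      then have "2 * r\<^sup>2 \<le> x \<bullet> x"
      proof -
        have "(2 * r)\<^sup>2 = 4 * r\<^sup>2" by (simp add: power_mult_distrib)
        then have "2 * r\<^sup>2 \<le> (norm x)\<^sup>2"
          using \<open>(2 * r)\<^sup>2 \<le> (norm x)\<^sup>2\<close> zero_le_power2[of r] by linarith
        then show ?thesis by (simp add: power2_norm_eq_inner)
      qed
      then have "2 - (x \<bullet> x) / r\<^sup>2 \<le> 0" using r(1) by (simp add: field_simps)
      then show False using that s(6) by (simp add: \<beta>_def)
    qed
  qed
qed

section \<open>Unitriangular maps\<close>

lemma less_induct_finite [case_names less]:
  fixes k :: "'n::{finite,linorder}"
  assumes "\<And>k. (\<And>j. j < k \<Longrightarrow> P j) \<Longrightarrow> P k"
  shows "P k"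
proof (induction "card {j. j < k}" arbitrary: k rule: less_induct)
  case less
  show ?case
  proof (rule assms)
    fix j assume "j < k"
    then have "{i. i < j} \<subset> {i. i < k}" by auto
    then have "card {i. i < j} < card {i. i < k}" by (intro psubset_card_mono) auto
    then show "P j" using less by blast
  qed
qed

text \<open>
  For a linear map this says that its matrix is lower triangular with ones on the diagonal. The
  formulation by vanishing initial coordinates composes and inverts without matrix computations, and
  expresses that \<open>F\<close> preserves the flag of the spaces \<^term>\<open>tail_span\<close> and is the identity on its quotients.
\<close>

definition unitriangular :: "(real^'n::{finite,linorder} \<Rightarrow> real^'n::{finite,linorder}) \<Rightarrow> bool" where
  "unitriangular F \<longleftrightarrow> (\<forall>w k. (\<forall>j<k. w $ j = 0) \<longrightarrow> F w $ k = w $ k)"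

lemma unitriangularD: "unitriangular F \<Longrightarrow> (\<And>j. j < k \<Longrightarrow> w $ j = 0) \<Longrightarrow> F w $ k = w $ k"
  by (auto simp: unitriangular_def)

lemma unitriangular_compose:
  fixes F G :: "real^'n::{finite,linorder} \<Rightarrow> real^'n::{finite,linorder}"
  assumes "unitriangular F" "unitriangular G"
  shows "unitriangular (\<lambda>w. F (G w))"
  unfolding unitriangular_def
proof (intro allI impI)
  fix w :: "(real, 'n) vec" and k assume w: "\<forall>j<k. w $ j = 0"
  have *: "G w $ j = w $ j" if "j \<le> k" for j
    using w that by (intro unitriangularD[OF assms(2)]) auto
  have "F (G w) $ k = G w $ k"
    using * w by (intro unitriangularD[OF assms(1)]) auto
  then show "F (G w) $ k = w $ k" using * by simp
qed

text \<open>
  If the first coordinate in which \<open>w\<close> is nonzero is \<open>k\<close>, then \<open>G w\<close> cannot have an earlier nonzero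
  coordinate: \<open>F\<close> would keep the first of them, whereas \<open>F (G w) = w\<close>.
\<close>

lemma unitriangular_inverse:
  fixes F G :: "real^'n::{finite,linorder} \<Rightarrow> real^'n::{finite,linorder}"
  assumes F: "unitriangular F" and FG: "\<And>w. F (G w) = w"
  shows "unitriangular G"
  unfolding unitriangular_def
proof (intro allI impI)
  fix w :: "(real, 'n) vec" and k assume w: "\<forall>j<k. w $ j = 0"
  have "j < k \<longrightarrow> G w $ j = 0" for j
  proof (induction j rule: less_induct_finite)
    case (less j)
    have "j < k \<Longrightarrow> F (G w) $ j = G w $ j"
      using less by (intro unitriangularD[OF F]) auto
    then show ?case using FG w by simp
  qed
  then have "F (G w) $ k = G w $ k" by (intro unitriangularD[OF F]) auto
  then show "G w $ k = w $ k" using FG by simp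
qed

lemma unitriangular_inj:
  fixes F :: "real^'n::{finite,linorder} \<Rightarrow> real^'n::{finite,linorder}"
  assumes "linear F" "unitriangular F"
  shows "inj F"
proof -
  have "w = 0" if "F w = 0" for w
  proof -
    have "w $ k = 0" for k
    proof (induction k rule: less_induct_finite)
      case (less k)
      then show ?case using unitriangularD[OF assms(2), of k w] that by simp
    qed
    then show ?thesis by (simp add: vec_eq_iff)
  qed
  then show ?thesis using linear_injective_0[OF assms(1)] by blast
qed

text \<open>
  The derivative of each coordinate of the solution only involves \<open>v\<close> and the earlier coordinates.
  As long as the data vanish in the earlier coordinates so does the solution, by induction, and the
  first coordinate in which they do not vanish moves with constant speed.
\<close>

lemma strictly_triangular_ode:
  fixes y :: "real \<Rightarrow> real^'n::{finite,linorder}"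
  assumes y: "\<And>t. (y has_vector_derivative G (y t) + v) (at t)"
    and G: "\<And>w k. (\<And>j. j < k \<Longrightarrow> w $ j = 0) \<Longrightarrow> G w $ k = 0"
    and zero: "\<And>j. j < k \<Longrightarrow> y 0 $ j = 0 \<and> v $ j = 0"
  shows "y t $ k = y 0 $ k + t * v $ k"
proof -
  have "\<forall>t. y t $ i = y 0 $ i + t * v $ i" if "i \<le> k" for i
    using that
  proof (induction i rule: less_induct_finite)
    case (less i)
    have "y t $ j = 0" if "j < i" for t j
    proof -
      have "j < k" using that less.prems by simp
      then show ?thesis using less.IH[OF that] zero[of j] by simp
    qed
    then have G0: "G (y t) $ i = 0" for t by (rule G)
    have "((\<lambda>t. y t $ i - t * v $ i) has_real_derivative 0) (at t)" for t
    proof -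
      have "((\<lambda>t. y t $ i) has_vector_derivative v $ i) (at t)"
        using bounded_linear.has_vector_derivative[OF bounded_linear_vec_nth[of i] y[of t]] G0[of t]
        by simp
      then have "((\<lambda>t. y t $ i) has_real_derivative v $ i) (at t)"
        by (simp add: has_real_derivative_iff_has_vector_derivative)
      then show ?thesis by (auto intro!: derivative_eq_intros)
    qed
    then have "y t $ i - t * v $ i = y 0 $ i - 0 * v $ i" for t
      using DERIV_isconst_all[where f = "\<lambda>t. y t $ i - t * v $ i"] by blast
    then have "y t $ i = y 0 $ i + t * v $ i" for t by (metis add.commute add.right_neutral diff_add_cancel diff_zero mult_zero_left)
    then show ?case by blast
  qed
  then show ?thesis by blast
qed

text \<open>
  In the Leibniz formula, a permutation other than the identity moves some index up, and the
  corresponding entry lies above the diagonal.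
\<close>

lemma det_unitriangular:
  fixes F :: "real^'n::{finite,linorder} \<Rightarrow> real^'n::{finite,linorder}"
  assumes "unitriangular F"
  shows "det (matrix F) = 1"
proof -
  let ?A = "matrix F"
  have A: "?A $ i $ j = F (axis j 1) $ i" for i j by (simp add: matrix_def)
  have diag: "?A $ i $ i = 1" for i
    unfolding A by (subst unitriangularD[OF assms]) (auto simp: axis_def)
  have up: "?A $ i $ j = 0" if "i < j" for i j
    unfolding A using that by (subst unitriangularD[OF assms]) (auto simp: axis_def)
  have "(\<Prod>i\<in>UNIV. ?A $ i $ p i) = 0" if p: "p permutes UNIV" "p \<noteq> id" for p
  proof -
    have "\<exists>i. i < p i"
    proof (rule ccontr)
      assume "\<nexists>i. i < p i"
      then have le: "p i \<le> i" for i by (simp add: not_less)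
      have "p i = i" for i
      proof (induction i rule: less_induct_finite)
        case (less i)
        show ?case
          using less[of "p i"] le[of i] injD[OF permutes_inj[OF p(1)], of "p i" i] by (auto simp: order_le_less)
      qed
      then show False using p(2) by auto
    qed
    then show ?thesis using up by (auto simp: prod_zero_iff)
  qed
  then have "(\<Sum>p\<in>{p. p permutes UNIV}. of_int (sign p) * (\<Prod>i\<in>UNIV. ?A $ i $ p i)) =
    (\<Sum>p\<in>{id}. of_int (sign p) * (\<Prod>i\<in>UNIV. ?A $ i $ p i))"
    by (intro sum.mono_neutral_right) (auto simp: permutes_id)
  then show ?thesis unfolding det_def by (simp add: diag sign_id)
qed

section \<open>Partial derivatives of the group law\<close>

lemma constant_speed:
  fixes f :: "real \<Rightarrow> real"
  assumes "\<And>s. (f has_real_derivative d) (at s)"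
  shows "f 1 = f 0 + d"
proof -
  have "f 1 - f 0 = (1 - 0) * d"
    using MVT2[of 0 1 f "\<lambda>_. d"] assms by auto
  then show ?thesis by simp
qed

lemma has_derivative_curve:
  assumes "(c has_vector_derivative u) (at s)" and "(f has_derivative f') (at (c s))"
  shows "((\<lambda>t. f (c t)) has_vector_derivative f' u) (at s)"
  using vector_derivative_diff_chain_within[OF assms(1) has_derivative_at_withinI[OF assms(2)]]
  by (simp add: o_def)

lemma has_vector_derivative_ray: "((\<lambda>s. s *\<^sub>R w) has_vector_derivative w) (at s)"
  by (auto intro!: derivative_eq_intros simp: has_vector_derivative_def)

lemma has_vector_derivative_line: "((\<lambda>s. b + s *\<^sub>R w) has_vector_derivative w) (at s)"
  by (auto intro!: derivative_eq_intros simp: has_vector_derivative_def)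

text \<open>
  The partial differentials of the group law at the point \<open>(a, b)\<close>, applied to \<open>w\<close>. They are taken
  from the joint derivative, so that their dependence on \<open>(a, b)\<close> is differentiable.
\<close>

definition Dmul_left where
  "Dmul_left mul a b w = frechet_derivative (\<lambda>z. mul (fst z) (snd z)) (at (a, b)) (w, 0)"

definition Dmul_right where
  "Dmul_right mul a b w = frechet_derivative (\<lambda>z. mul (fst z) (snd z)) (at (a, b)) (0, w)"

context nilpotent_group
begin

interpretation group mul 0 inv by (rule group)

lemma mul_assoc: "mul (mul a b) c = mul a (mul b c)" by (rule assoc)

lemma mul_0 [simp]: "mul 0 a = a" "mul a 0 = a"
  by simp_all

lemma mul_uminus [simp]: "mul a (- a) = 0" "mul (- a) a = 0"
  using exp_coords[of 1 a "-1"] exp_coords[of "-1" a 1] by simp_all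

lemma mul_uminus_cancel [simp]: "mul (- a) (mul a b) = b" "mul a (mul (- a) b) = b"
  by (simp_all add: mul_assoc[symmetric] del: mul_assoc)

lemma Ck_1_mul: "Ck 1 (\<lambda>z. mul (fst z) (snd z))"
  using smooth_mul unfolding smooth_def by blast

lemma Ck_1_derivative_mul: "Ck 1 (\<lambda>z. frechet_derivative (\<lambda>z. mul (fst z) (snd z)) (at z) v)"
proof -
  have "Ck (Suc 1) (\<lambda>z. mul (fst z) (snd z))"
    using smooth_mul unfolding smooth_def by blast
  then show ?thesis by (subst (asm) Ck.simps) blast
qed

lemma derivative_mul_eq:
  "frechet_derivative (\<lambda>z. mul (fst z) (snd z)) (at (a, b)) (u, w) =
     Dmul_left mul a b u + Dmul_right mul a b w"
proof -
  have "linear (frechet_derivative (\<lambda>z. mul (fst z) (snd z)) (at (a, b)))"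
    by (rule Ck_1_linear_derivative[OF Ck_1_mul])
  from linear_add[OF this, of "(u, 0)" "(0, w)"] show ?thesis
    by (simp add: Dmul_left_def Dmul_right_def)
qed

lemma linear_Dmul: "linear (Dmul_left mul a b)" "linear (Dmul_right mul a b)"
proof -
  have l: "linear (frechet_derivative (\<lambda>z. mul (fst z) (snd z)) (at (a, b)))"
    by (rule Ck_1_linear_derivative[OF Ck_1_mul])
  show "linear (Dmul_left mul a b)" unfolding Dmul_left_def
    by (intro linearI) (use linear_add[OF l, of "(x,0)" "(y,0)" for x y] linear_scale[OF l, of _ "(x,0)" for x] in auto)
  show "linear (Dmul_right mul a b)" unfolding Dmul_right_def
    by (intro linearI) (use linear_add[OF l, of "(0,x)" "(0,y)" for x y] linear_scale[OF l, of _ "(0,x)" for x] in auto)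
qed

lemma has_vector_derivative_mul:
  assumes "(f has_vector_derivative u) (at s)" "(h has_vector_derivative w) (at s)"
  shows "((\<lambda>s. mul (f s) (h s)) has_vector_derivative
           Dmul_left mul (f s) (h s) u + Dmul_right mul (f s) (h s) w) (at s)"
  using has_derivative_curve[OF has_vector_derivative_Pair[OF assms]
      Ck_1_has_derivative[OF Ck_1_mul]]
  by (simp add: derivative_mul_eq)

lemma has_vector_derivative_mul_left:
  assumes "(f has_vector_derivative u) (at s)"
  shows "((\<lambda>s. mul (f s) b) has_vector_derivative Dmul_left mul (f s) b u) (at s)"
  using has_vector_derivative_mul[OF assms has_vector_derivative_const[of b]] linear_0[OF linear_Dmul(2)]
  by simp

lemma has_vector_derivative_mul_right:
  assumes "(h has_vector_derivative w) (at s)"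
  shows "((\<lambda>s. mul a (h s)) has_vector_derivative Dmul_right mul a (h s) w) (at s)"
  using has_vector_derivative_mul[OF has_vector_derivative_const[of a] assms] linear_0[OF linear_Dmul(1)]
  by simp

lemma has_derivative_mul_right: "(mul a has_derivative Dmul_right mul a b) (at b)"
proof -
  have "((\<lambda>q. mul (fst (a, q)) (snd (a, q))) has_derivative
     (\<lambda>v. frechet_derivative (\<lambda>z. mul (fst z) (snd z)) (at (a, b)) (0, v))) (at b)"
    by (rule has_derivative_compose[OF _ Ck_1_has_derivative[OF Ck_1_mul], of "\<lambda>q. (a, q)"])
       (auto intro!: derivative_eq_intros)
  then show ?thesis by (simp add: Dmul_right_def[abs_def])
qed

lemma frechet_derivative_mul: "frechet_derivative (mul a) (at b) = Dmul_right mul a b"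
  by (rule frechet_derivative_eq[OF has_derivative_mul_right])

lemma left_inv_field_eq: "left_inv_field mul u p = Dmul_right mul p 0 u"
  by (simp add: left_inv_field_def frechet_derivative_mul)

lemma Dmul_left_0 [simp]: "Dmul_left mul a 0 w = w"
proof -
  have "((\<lambda>s. mul (a + s *\<^sub>R w) 0) has_vector_derivative Dmul_left mul (a + 0 *\<^sub>R w) 0 w) (at 0)"
    by (rule has_vector_derivative_mul_left[OF has_vector_derivative_line])
  then show ?thesis
    using vector_derivative_unique_at[OF _ has_vector_derivative_line[of a w 0]] by simp
qed

lemma Dmul_right_0 [simp]: "Dmul_right mul 0 b w = w"
proof -
  have "((\<lambda>s. mul 0 (b + s *\<^sub>R w)) has_vector_derivative Dmul_right mul 0 (b + 0 *\<^sub>R w) w) (at 0)"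
    by (rule has_vector_derivative_mul_right[OF has_vector_derivative_line])
  then show ?thesis
    using vector_derivative_unique_at[OF _ has_vector_derivative_line[of b w 0]] by simp
qed

lemma Ck_1_Dmul:
  "Ck 1 (\<lambda>z. Dmul_left mul (fst z) (snd z) w)" "Ck 1 (\<lambda>z. Dmul_right mul (fst z) (snd z) w)"
  using Ck_1_derivative_mul by (simp_all add: Dmul_left_def Dmul_right_def del: One_nat_def)

lemma Ck_1_left_inv_field: "Ck 1 (left_inv_field mul w)"
  using Ck_1_compose[OF Ck_1_Dmul(2) Ck_1_Pair[OF Ck_1_bounded_linear[OF bounded_linear_ident] Ck_1_const[of 0]], of w]
  by (simp add: left_inv_field_eq[abs_def] del: One_nat_def)

section \<open>The Lie bracket and strict triangularity\<close>

text \<open>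
  The mixed second derivative of the group law at the identity. In exponential coordinates it is
  half the Lie bracket, since it vanishes on the diagonal and is therefore antisymmetric.
\<close>

definition half_bracket where
  "half_bracket x w = frechet_derivative (left_inv_field mul w) (at 0) x"

lemma has_vector_derivative_left_inv_field:
  assumes "(f has_vector_derivative x) (at s)" "f s = 0"
  shows "((\<lambda>s. Dmul_right mul (f s) 0 w) has_vector_derivative half_bracket x w) (at s)"
  using has_derivative_curve[OF assms(1) Ck_1_has_derivative[OF Ck_1_left_inv_field]] assms(2)
  by (simp add: left_inv_field_eq half_bracket_def)

lemma half_bracket_left_linear: "linear (\<lambda>x. half_bracket x w)"
  unfolding half_bracket_def by (rule Ck_1_linear_derivative[OF Ck_1_left_inv_field])

lemma half_bracket_right_linear: "linear (half_bracket x)"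
proof (rule linearI)
  fix u w
  have "((\<lambda>s. Dmul_right mul (s *\<^sub>R x) 0 u + Dmul_right mul (s *\<^sub>R x) 0 w)
     has_vector_derivative half_bracket x u + half_bracket x w) (at 0)"
    by (intro has_vector_derivative_add has_vector_derivative_left_inv_field has_vector_derivative_ray) simp_all
  moreover have "((\<lambda>s. Dmul_right mul (s *\<^sub>R x) 0 (u + w)) has_vector_derivative half_bracket x (u + w)) (at 0)"
    by (intro has_vector_derivative_left_inv_field has_vector_derivative_ray) simp
  ultimately show "half_bracket x (u + w) = half_bracket x u + half_bracket x w"
    by (simp add: linear_add[OF linear_Dmul(2)] vector_derivative_unique_at)
next
  fix a w
  have "((\<lambda>s. a *\<^sub>R Dmul_right mul (s *\<^sub>R x) 0 w) has_vector_derivative a *\<^sub>R half_bracket x w) (at 0)"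
    by (rule bounded_linear.has_vector_derivative[OF bounded_linear_scaleR_right])
       (auto intro: has_vector_derivative_left_inv_field has_vector_derivative_ray)
  moreover have "((\<lambda>s. Dmul_right mul (s *\<^sub>R x) 0 (a *\<^sub>R w)) has_vector_derivative half_bracket x (a *\<^sub>R w)) (at 0)"
    by (intro has_vector_derivative_left_inv_field has_vector_derivative_ray) simp
  ultimately show "half_bracket x (a *\<^sub>R w) = a *\<^sub>R half_bracket x w"
    by (simp add: linear_scale[OF linear_Dmul(2)] vector_derivative_unique_at)
qed

text \<open>
  The ray \<open>t \<mapsto> t x\<close> is the one-parameter group with velocity \<open>x\<close>, hence an integral curve of the
  left-invariant field through \<open>x\<close>.
\<close>

lemma left_inv_field_radial: "Dmul_right mul (s *\<^sub>R x) (t *\<^sub>R x) x = x"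
proof -
  have "((\<lambda>t. mul (s *\<^sub>R x) (t *\<^sub>R x)) has_vector_derivative Dmul_right mul (s *\<^sub>R x) (t *\<^sub>R x) x) (at t)"
    by (rule has_vector_derivative_mul_right[OF has_vector_derivative_ray])
  moreover have "((\<lambda>t. s *\<^sub>R x + t *\<^sub>R x) has_vector_derivative x) (at t)"
    by (rule has_vector_derivative_line)
  ultimately show ?thesis
    by (simp add: exp_coords scaleR_add_left vector_derivative_unique_at)
qed

text \<open>
  The left-invariant field through \<open>x\<close> is constant along the ray through \<open>x\<close>.
\<close>

lemma half_bracket_same: "half_bracket x x = 0"
proof -
  have "((\<lambda>s. Dmul_right mul (s *\<^sub>R x) 0 x) has_vector_derivative half_bracket x x) (at 0)"
    by (intro has_vector_derivative_left_inv_field has_vector_derivative_ray) simp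
  moreover have "((\<lambda>s. Dmul_right mul (s *\<^sub>R x) 0 x) has_vector_derivative 0) (at 0)"
    using left_inv_field_radial[of _ x 0] by simp
  ultimately show ?thesis by (rule vector_derivative_unique_at)
qed

lemma half_bracket_antisym: "half_bracket w x = - half_bracket x w"
  using half_bracket_same[of "x + w"] half_bracket_same[of x] half_bracket_same[of w]
  by (simp add: linear_add[OF half_bracket_left_linear] linear_add[OF half_bracket_right_linear]
      add_eq_0_iff2)

lemma lie_bracket_eq: "lie_bracket mul x w = 2 *\<^sub>R half_bracket x w"
proof -
  have "lie_bracket mul x w = half_bracket x w - half_bracket w x"
    by (simp add: lie_bracket_def vf_bracket_def half_bracket_def left_inv_field_eq)
  then show ?thesis using half_bracket_antisym[of w x] by (simp add: scaleR_2)
qed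

lemma tail_span_iff: "w \<in> tail_span k \<longleftrightarrow> (\<forall>j<k. w $ j = 0)"
proof
  assume "w \<in> tail_span k"
  then show "\<forall>j<k. w $ j = 0"
    unfolding tail_span_def
    by (induction rule: span_induct_alt) (auto simp: axis_def split: if_splits)
next
  assume w: "\<forall>j<k. w $ j = 0"
  have "(\<Sum>j\<in>UNIV. w $ j *\<^sub>R axis j 1) \<in> tail_span k"
    unfolding tail_span_def
  proof (rule span_sum)
    fix j
    show "w $ j *\<^sub>R axis j 1 \<in> span {axis j 1 |j. k \<le> j}"
    proof (cases "j < k")
      case True
      then show ?thesis using w by (simp add: span_zero)
    next
      case False
      then show ?thesis by (intro span_scale span_base) auto
    qed
  qed
  then show "w \<in> tail_span k"
    using basis_expansion[of w] by (simp add: scalar_mult_eq_scaleR)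
qed

lemma linear_lie_bracket: "linear (lie_bracket mul x)"
  using linear_compose_scale_right[OF half_bracket_right_linear, of 2 x] by (simp add: lie_bracket_eq[abs_def])

lemma lie_bracket_tail_span: "w \<in> tail_span k \<Longrightarrow> lie_bracket mul x w \<in> tail_span k"
  using malcev_ideal[of k] by (auto simp: lie_ideal_def)

text \<open>
  Each \<open>axis j 1\<close> with \<open>k < j\<close> lies in the ideal \<^term>\<open>tail_span j\<close>, whose elements have no \<open>k\<close>-th coordinate.
\<close>

lemma lie_bracket_above_diagonal:
  assumes "\<And>j. j \<le> k \<Longrightarrow> w $ j = 0"
  shows "lie_bracket mul x w $ k = 0"
proof -
  have "lie_bracket mul x w = lie_bracket mul x (\<Sum>j\<in>UNIV. w $ j *\<^sub>R axis j 1)"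
    using basis_expansion[of w] by (simp add: scalar_mult_eq_scaleR)
  also have "\<dots> = (\<Sum>j\<in>UNIV. w $ j *\<^sub>R lie_bracket mul x (axis j 1))"
    by (simp add: linear_sum[OF linear_lie_bracket] linear_scale[OF linear_lie_bracket])
  finally have "lie_bracket mul x w $ k = (\<Sum>j\<in>UNIV. w $ j * lie_bracket mul x (axis j 1) $ k)"
    by simp
  moreover have "w $ j * lie_bracket mul x (axis j 1) $ k = 0" for j
  proof (cases "j \<le> k")
    case False
    have "axis j 1 \<in> tail_span j" by (auto simp: tail_span_iff axis_def)
    then have "lie_bracket mul x (axis j 1) \<in> tail_span j" by (rule lie_bracket_tail_span)
    then show ?thesis using False by (auto simp: tail_span_iff)
  qed (use assms in auto)
  ultimately show ?thesis by (simp only: sum.neutral_const)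
qed

lemma lie_bracket_leading_coordinate:
  assumes "w \<in> tail_span k"
  shows "lie_bracket mul x w $ k = w $ k * lie_bracket mul x (axis k 1) $ k"
proof -
  let ?u = "w - w $ k *\<^sub>R axis k 1"
  have "?u $ j = 0" if "j \<le> k" for j
    using that assms by (cases "j = k") (auto simp: tail_span_iff axis_def)
  then have "lie_bracket mul x ?u $ k = 0" by (rule lie_bracket_above_diagonal)
  then show ?thesis
    by (simp add: linear_diff[OF linear_lie_bracket] linear_scale[OF linear_lie_bracket])
qed

text \<open>
  Since the spaces \<^term>\<open>tail_span k\<close> are ideals, \<open>ad x\<close> is triangular. Its \<open>k\<close>-th diagonal entry \<open>a\<close> is zero:
  the \<open>m\<close>-th iterate of \<open>ad x\<close> on the \<open>k\<close>-th basis vector has \<open>k\<close>-th coordinate \<open>a ^ m\<close> and lies in the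
  \<open>m\<close>-th term of the lower central series, which is trivial for \<open>m = r\<close>.
\<close>

lemma lie_bracket_strictly_triangular:
  assumes "\<And>j. j < k \<Longrightarrow> w $ j = 0"
  shows "lie_bracket mul x w $ k = 0"
proof -
  define a where "a = lie_bracket mul x (axis k 1) $ k"
  have "(lie_bracket mul x ^^ m) (axis k 1) \<in> lower_central mul m \<inter> tail_span k \<and>
    (lie_bracket mul x ^^ m) (axis k 1) $ k = a ^ m" for m
  proof (induction m)
    case 0
    show ?case by (auto simp: tail_span_iff axis_def)
  next
    case (Suc m)
    let ?v = "(lie_bracket mul x ^^ m) (axis k 1)"
    have "lie_bracket mul x ?v \<in> lower_central mul (Suc m)"
      using Suc by (auto intro!: span_base)
    moreover have "lie_bracket mul x ?v \<in> tail_span k"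
      using Suc by (intro lie_bracket_tail_span) simp
    moreover have "lie_bracket mul x ?v $ k = a ^ Suc m"
      using Suc by (subst lie_bracket_leading_coordinate) (auto simp: a_def[symmetric])
    ultimately show ?case by (simp del: lower_central.simps)
  qed
  from this[of r] have "(lie_bracket mul x ^^ r) (axis k 1) = 0" "(lie_bracket mul x ^^ r) (axis k 1) $ k = a ^ r"
    using step_trivial by (simp, blast)
  then have "a ^ r = 0" by (metis zero_index)
  then have "a = 0" by simp
  then show ?thesis
    using lie_bracket_leading_coordinate[of w k x] assms by (auto simp: a_def[symmetric] tail_span_iff)
qed

section \<open>The adjoint action and the differentials of translations\<close>

text \<open>
  The differential at the identity of conjugation by \<open>p\<close>; the inverse of \<open>p\<close> is \<open>- p\<close> in exponential
  coordinates.
\<close>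

definition Ad where
  "Ad p u = Dmul_left mul p (- p) (Dmul_right mul p 0 u)"

lemma has_vector_derivative_conjugate:
  assumes "(f has_vector_derivative u) (at s)" "f s = 0"
  shows "((\<lambda>s. mul (mul p (f s)) (- p)) has_vector_derivative Ad p u) (at s)"
  using has_vector_derivative_mul_left[OF has_vector_derivative_mul_right[OF assms(1)], of p "- p"] assms(2)
  by (simp add: Ad_def)

lemma Ad_0 [simp]: "Ad 0 u = u"
  by (simp add: Ad_def)

lemma Ad_Ad: "Ad (s *\<^sub>R x) (Ad (t *\<^sub>R x) w) = Ad ((t + s) *\<^sub>R x) w"
proof -
  have eq: "mul (mul (s *\<^sub>R x) (mul (mul (t *\<^sub>R x) q) (- (t *\<^sub>R x)))) (- (s *\<^sub>R x)) =
    mul (mul ((t + s) *\<^sub>R x) q) (- ((t + s) *\<^sub>R x))" for q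
  proof -
    have "(t + s) *\<^sub>R x = mul (s *\<^sub>R x) (t *\<^sub>R x)" by (simp add: exp_coords add.commute)
    moreover have "- ((t + s) *\<^sub>R x) = mul (- (t *\<^sub>R x)) (- (s *\<^sub>R x))"
      using exp_coords[of "-t" x "-s"] by (simp add: algebra_simps)
    ultimately show ?thesis by (simp add: mul_assoc)
  qed
  have "((\<lambda>h. mul (mul (s *\<^sub>R x) (mul (mul (t *\<^sub>R x) (h *\<^sub>R w)) (- (t *\<^sub>R x)))) (- (s *\<^sub>R x)))
     has_vector_derivative Ad (s *\<^sub>R x) (Ad (t *\<^sub>R x) w)) (at 0)"
    by (intro has_vector_derivative_conjugate has_vector_derivative_ray) simp_all
  moreover have "((\<lambda>h. mul (mul ((t + s) *\<^sub>R x) (h *\<^sub>R w)) (- ((t + s) *\<^sub>R x)))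
     has_vector_derivative Ad ((t + s) *\<^sub>R x) w) (at 0)"
    by (intro has_vector_derivative_conjugate has_vector_derivative_ray) simp_all
  ultimately show ?thesis unfolding eq by (rule vector_derivative_unique_at)
qed

text \<open>
  Differentiate \<open>y \<cdot> y = 2 y\<close> at \<open>y = h x\<close> in the direction \<open>h w\<close>, and divide by \<open>h\<close>.
\<close>

lemma Dmul_square: "Dmul_left mul (h *\<^sub>R x) (h *\<^sub>R x) w + Dmul_right mul (h *\<^sub>R x) (h *\<^sub>R x) w = 2 *\<^sub>R w"
proof (cases "h = 0")
  case True
  then show ?thesis by (simp add: scaleR_2)
next
  case False
  have d: "((\<lambda>s. h *\<^sub>R (x + s *\<^sub>R w)) has_vector_derivative h *\<^sub>R w) (at 0)"
    by (intro bounded_linear.has_vector_derivative[OF bounded_linear_scaleR_right] has_vector_derivative_line)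
  have "((\<lambda>s. mul (h *\<^sub>R (x + s *\<^sub>R w)) (h *\<^sub>R (x + s *\<^sub>R w))) has_vector_derivative
    h *\<^sub>R (Dmul_left mul (h *\<^sub>R x) (h *\<^sub>R x) w + Dmul_right mul (h *\<^sub>R x) (h *\<^sub>R x) w)) (at 0)"
    using has_vector_derivative_mul[OF d d]
    by (simp add: linear_scale[OF linear_Dmul(1)] linear_scale[OF linear_Dmul(2)] scaleR_add_right)
  moreover have "((\<lambda>s. 2 *\<^sub>R (h *\<^sub>R (x + s *\<^sub>R w))) has_vector_derivative 2 *\<^sub>R (h *\<^sub>R w)) (at 0)"
    by (intro bounded_linear.has_vector_derivative[OF bounded_linear_scaleR_right] d)
  moreover have "mul (h *\<^sub>R (x + s *\<^sub>R w)) (h *\<^sub>R (x + s *\<^sub>R w)) = 2 *\<^sub>R (h *\<^sub>R (x + s *\<^sub>R w))" for s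
    by (simp add: exp_coords)
  ultimately have "h *\<^sub>R (Dmul_left mul (h *\<^sub>R x) (h *\<^sub>R x) w + Dmul_right mul (h *\<^sub>R x) (h *\<^sub>R x) w) =
    2 *\<^sub>R (h *\<^sub>R w)"
    by (simp add: vector_derivative_unique_at)
  then have "h *\<^sub>R (Dmul_left mul (h *\<^sub>R x) (h *\<^sub>R x) w + Dmul_right mul (h *\<^sub>R x) (h *\<^sub>R x) w) =
    h *\<^sub>R (2 *\<^sub>R w)" by (simp add: scaleR_left_commute)
  then show ?thesis using False by (simp only: scaleR_cancel_left) simp
qed

text \<open>
  Differentiating the previous identity at \<open>h = 0\<close> shows that the first-order variation of the left
  partial differential in its second argument is opposite to that of the right partial differential
  in its first argument, the variations in the respective other arguments being zero. This relation
  between the two mixed second derivatives is what identifies the derivative of \<^term>\<open>Ad\<close> with the Lie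
  bracket.
\<close>

lemma has_vector_derivative_Dmul_left_anti:
  "((\<lambda>h. Dmul_left mul (h *\<^sub>R x) (- (h *\<^sub>R x)) w) has_vector_derivative half_bracket x w) (at 0)"
proof -
  define H where "H = (\<lambda>z. Dmul_left mul (fst z) (snd z) w)"
  define G where "G = (\<lambda>z. Dmul_right mul (fst z) (snd z) w)"
  define H' where "H' = frechet_derivative H (at (0, 0))"
  define G' where "G' = frechet_derivative G (at (0, 0))"
  have H: "(H has_derivative H') (at (0, 0))" and G: "(G has_derivative G') (at (0, 0))"
    unfolding H'_def G'_def H_def G_def by (intro Ck_1_has_derivative Ck_1_Dmul)+
  have curve: "((\<lambda>h. (h *\<^sub>R a, h *\<^sub>R b)) has_vector_derivative (a, b)) (at 0)" for a b :: "(real, 'n) vec"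
    by (intro has_vector_derivative_Pair has_vector_derivative_ray)
  have Hc: "((\<lambda>h. H (h *\<^sub>R a, h *\<^sub>R b)) has_vector_derivative H' (a, b)) (at 0)" for a b
    using has_derivative_curve[OF curve] H by simp
  have Gc: "((\<lambda>h. G (h *\<^sub>R a, h *\<^sub>R b)) has_vector_derivative G' (a, b)) (at 0)" for a b
    using has_derivative_curve[OF curve] G by simp
  have H1: "H' (x, 0) = 0"
    using vector_derivative_unique_at[OF Hc[of x 0]] by (simp add: H_def)
  have G1: "G' (0, x) = 0"
    using vector_derivative_unique_at[OF Gc[of 0 x]] by (simp add: G_def)
  have G2: "G' (x, 0) = half_bracket x w"
    using vector_derivative_unique_at[OF Gc[of x 0]]
      has_vector_derivative_left_inv_field[OF has_vector_derivative_ray[of x 0], of w]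
    by (simp add: G_def)
  have "H' (x, x) + G' (x, x) = 0"
    using vector_derivative_unique_at[OF has_vector_derivative_add[OF Hc[of x x] Gc[of x x]]]
    by (simp add: G_def H_def Dmul_square)
  moreover have "H' (x, x) = H' (x, 0) + H' (0, x)" "G' (x, x) = G' (x, 0) + G' (0, x)"
    using linear_add[OF has_derivative_linear[OF H], of "(x, 0)" "(0, x)"]
      linear_add[OF has_derivative_linear[OF G], of "(x, 0)" "(0, x)"] by simp_all
  ultimately have H2: "H' (0, x) = - half_bracket x w"
    using H1 G1 G2 by (simp add: add_eq_0_iff2)
  have "H' (x, - x) = half_bracket x w"
    using linear_diff[OF has_derivative_linear[OF H], of "(x, 0)" "(0, x)"] H1 H2 by simp
  then show ?thesis using Hc[of x "- x"] by (simp add: H_def)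
qed

text \<open>
  In \<open>Ad (h x) w\<close> the inner differential, at \<open>(h x, 0)\<close>, and the outer one, at \<open>(h x, - h x)\<close>, vary to first order by
  the same amount \<^term>\<open>half_bracket x w\<close>; the two halves add up to the bracket.
\<close>

lemma has_vector_derivative_Ad_0:
  "((\<lambda>h. Ad (h *\<^sub>R x) w) has_vector_derivative lie_bracket mul x w) (at 0)"
proof -
  let ?l = "\<lambda>h. Dmul_right mul (h *\<^sub>R x) 0 w"
  let ?H = "\<lambda>h j. Dmul_left mul (h *\<^sub>R x) (- (h *\<^sub>R x)) (axis j 1)"
  have exp: "(\<Sum>j\<in>UNIV. u $ j *\<^sub>R axis j 1) = u" for u :: "(real, 'n) vec"
    using basis_expansion[of u] by (simp add: scalar_mult_eq_scaleR)
  have l: "(?l has_vector_derivative half_bracket x w) (at 0)"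
    by (intro has_vector_derivative_left_inv_field has_vector_derivative_ray) simp
  have lj: "((\<lambda>h. ?l h $ j) has_real_derivative half_bracket x w $ j) (at 0)" for j
    using bounded_linear.has_vector_derivative[OF bounded_linear_vec_nth[of j] l]
    by (simp add: has_real_derivative_iff_has_vector_derivative)
  have "((\<lambda>h. \<Sum>j\<in>UNIV. ?l h $ j *\<^sub>R ?H h j) has_vector_derivative
     (\<Sum>j\<in>UNIV. ?l 0 $ j *\<^sub>R half_bracket x (axis j 1) + half_bracket x w $ j *\<^sub>R ?H 0 j)) (at 0)"
    by (intro has_vector_derivative_sum has_vector_derivative_scaleR lj has_vector_derivative_Dmul_left_anti)
  moreover have "(\<Sum>j\<in>UNIV. ?l h $ j *\<^sub>R ?H h j) = Ad (h *\<^sub>R x) w" for h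
    using linear_expand_vec[OF linear_Dmul(1), of "h *\<^sub>R x" "- (h *\<^sub>R x)" "?l h"] by (simp add: Ad_def)
  moreover have "(\<Sum>j\<in>UNIV. ?l 0 $ j *\<^sub>R half_bracket x (axis j 1) + half_bracket x w $ j *\<^sub>R ?H 0 j) =
     lie_bracket mul x w"
    by (simp add: sum.distrib exp lie_bracket_eq scaleR_2 linear_expand_vec[OF half_bracket_right_linear, of x w, symmetric])
  ultimately show ?thesis by simp
qed

lemma has_vector_derivative_shift:
  assumes "((\<lambda>h. y (t + h)) has_vector_derivative d) (at 0)"
  shows "(y has_vector_derivative d) (at t)"
proof -
  have "((\<lambda>\<tau>. \<tau> - t) has_vector_derivative 1) (at t)"
    by (auto intro!: derivative_eq_intros simp: has_real_derivative_iff_has_vector_derivative[symmetric])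
  from vector_diff_chain_at[OF this, of "\<lambda>h. y (t + h)" d] show ?thesis
    using assms by (simp add: o_def)
qed

text \<open>
  The homomorphism property gives \<open>t \<mapsto> Ad (t x) w\<close> as a solution of \<open>y' = [x, y]\<close>, and \<open>ad x\<close> is strictly
  triangular.
\<close>

lemma unitriangular_Ad: "unitriangular (Ad x)"
  unfolding unitriangular_def
proof (intro allI impI)
  fix w :: "(real, 'n) vec" and k assume w: "\<forall>j<k. w $ j = 0"
  have "((\<lambda>t. Ad (t *\<^sub>R x) w) has_vector_derivative lie_bracket mul x (Ad (t *\<^sub>R x) w) + 0) (at t)" for t
    by (rule has_vector_derivative_shift)
       (use has_vector_derivative_Ad_0[of x "Ad (t *\<^sub>R x) w"] in \<open>simp add: Ad_Ad\<close>)
  then have "Ad (1 *\<^sub>R x) w $ k = Ad (0 *\<^sub>R x) w $ k + 1 * 0 $ k"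
  proof (rule strictly_triangular_ode[where y = "\<lambda>t. Ad (t *\<^sub>R x) w" and G = "lie_bracket mul x" and v = 0])
    show "lie_bracket mul x u $ i = 0" if "\<And>j. j < i \<Longrightarrow> u $ j = 0" for u i
      using that by (rule lie_bracket_strictly_triangular)
    show "Ad (0 *\<^sub>R x) w $ j = 0 \<and> 0 $ j = (0::real)" if "j < k" for j
      using w that by simp
  qed
  then show "Ad x w $ k = w $ k" by simp
qed

text \<open>
  Let \<open>c t\<close> be the variation of \<open>t x\<close> in the direction \<open>t v\<close>, translated back to the identity from the
  left. Writing \<open>(t + h) y = (t y) \<cdot> (h y)\<close> with \<open>y = x + s v\<close> and differentiating in \<open>s\<close> gives
  \<open>c (t + h) = Ad (- h x) (c t) + c h\<close>.
\<close>

lemma log_derivative_cocycle: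
  "Dmul_right mul (- ((t + h) *\<^sub>R x)) ((t + h) *\<^sub>R x) ((t + h) *\<^sub>R v) =
     Ad (- (h *\<^sub>R x)) (Dmul_right mul (- (t *\<^sub>R x)) (t *\<^sub>R x) (t *\<^sub>R v)) +
     Dmul_right mul (- (h *\<^sub>R x)) (h *\<^sub>R x) (h *\<^sub>R v)"
proof -
  have line: "((\<lambda>s. a *\<^sub>R (x + s *\<^sub>R v)) has_vector_derivative a *\<^sub>R v) (at 0)" for a
    by (intro bounded_linear.has_vector_derivative[OF bounded_linear_scaleR_right] has_vector_derivative_line)
  let ?f = "\<lambda>s. mul (- (t *\<^sub>R x)) (t *\<^sub>R (x + s *\<^sub>R v))"
  have f: "(?f has_vector_derivative Dmul_right mul (- (t *\<^sub>R x)) (t *\<^sub>R x) (t *\<^sub>R v)) (at 0)"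
    using has_vector_derivative_mul_right[OF line[of t]] by simp
  have f0: "?f 0 = 0" by simp
  have "((\<lambda>s. mul (mul (- (h *\<^sub>R x)) (?f s)) (h *\<^sub>R (x + s *\<^sub>R v))) has_vector_derivative
     Ad (- (h *\<^sub>R x)) (Dmul_right mul (- (t *\<^sub>R x)) (t *\<^sub>R x) (t *\<^sub>R v)) +
     Dmul_right mul (- (h *\<^sub>R x)) (h *\<^sub>R x) (h *\<^sub>R v)) (at 0)"
    using has_vector_derivative_mul[OF has_vector_derivative_mul_right[OF f, of "- (h *\<^sub>R x)"] line[of h]]
    by (simp add: Ad_def)
  moreover have "mul (mul (- (h *\<^sub>R x)) (?f s)) (h *\<^sub>R (x + s *\<^sub>R v)) =
    mul (- ((t + h) *\<^sub>R x)) ((t + h) *\<^sub>R (x + s *\<^sub>R v))" for s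
  proof -
    have "(t + h) *\<^sub>R (x + s *\<^sub>R v) = mul (t *\<^sub>R (x + s *\<^sub>R v)) (h *\<^sub>R (x + s *\<^sub>R v))"
      by (simp only: exp_coords)
    moreover have "- ((t + h) *\<^sub>R x) = mul (- (h *\<^sub>R x)) (- (t *\<^sub>R x))"
      using exp_coords[of "-h" x "-t"] by (simp add: algebra_simps)
    ultimately show ?thesis by (simp add: mul_assoc)
  qed
  moreover have "((\<lambda>s. mul (- ((t + h) *\<^sub>R x)) ((t + h) *\<^sub>R (x + s *\<^sub>R v))) has_vector_derivative
    Dmul_right mul (- ((t + h) *\<^sub>R x)) ((t + h) *\<^sub>R x) ((t + h) *\<^sub>R v)) (at 0)"
    using has_vector_derivative_mul_right[OF line[of "t + h"]] by simp
  ultimately show ?thesis by (simp add: vector_derivative_unique_at)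
qed

text \<open>
  By the cocycle identity \<open>c\<close> solves \<open>c' = - [x, c] + v\<close> with \<open>c 0 = 0\<close>, so its first coordinate not forced
  to vanish is \<open>t\<close> times that of \<open>v\<close>.
\<close>

lemma unitriangular_log_derivative: "unitriangular (Dmul_right mul (- x) x)"
  unfolding unitriangular_def
proof (intro allI impI)
  fix v :: "(real, 'n) vec" and k assume v: "\<forall>j<k. v $ j = 0"
  define S where "S t = Dmul_right mul (- (t *\<^sub>R x)) (t *\<^sub>R x) v" for t
  define c where "c t = Dmul_right mul (- (t *\<^sub>R x)) (t *\<^sub>R x) (t *\<^sub>R v)" for t
  have c: "c = (\<lambda>t. t *\<^sub>R S t)" by (simp add: fun_eq_iff c_def S_def linear_scale[OF linear_Dmul(2)])
  have "((\<lambda>t. (t *\<^sub>R (- x), t *\<^sub>R x)) has_vector_derivative (- x, x)) (at 0)"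
    by (intro has_vector_derivative_Pair has_vector_derivative_ray)
  from has_derivative_curve[OF this Ck_1_has_derivative[OF Ck_1_Dmul(2)], of v]
  obtain d where "(S has_vector_derivative d) (at 0)" by (auto simp: S_def[abs_def])
  from has_vector_derivative_scaleR[OF DERIV_ident this]
  have c0: "(c has_vector_derivative v) (at 0)" by (simp add: c S_def)
  have "(c has_vector_derivative - lie_bracket mul x (c t) + v) (at t)" for t
  proof (rule has_vector_derivative_shift)
    have "((\<lambda>h. Ad (h *\<^sub>R (- x)) (c t) + c h) has_vector_derivative lie_bracket mul (- x) (c t) + v) (at 0)"
      by (intro has_vector_derivative_add has_vector_derivative_Ad_0 c0)
    moreover have "lie_bracket mul (- x) (c t) = - lie_bracket mul x (c t)"
      by (simp add: lie_bracket_eq linear_neg[OF half_bracket_left_linear])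
    moreover have "c (t + h) = Ad (h *\<^sub>R (- x)) (c t) + c h" for h
      unfolding c_def using log_derivative_cocycle[of t h x v] by simp
    ultimately show "((\<lambda>h. c (t + h)) has_vector_derivative - lie_bracket mul x (c t) + v) (at 0)"
      by simp
  qed
  then have "c 1 $ k = c 0 $ k + 1 * v $ k"
  proof (rule strictly_triangular_ode[where y = c and G = "\<lambda>u. - lie_bracket mul x u" and v = v])
    show "(- lie_bracket mul x u) $ i = 0" if "\<And>j. j < i \<Longrightarrow> u $ j = 0" for u i
      using lie_bracket_strictly_triangular[of i u x] that by simp
    show "c 0 $ j = 0 \<and> v $ j = 0" if "j < k" for j
      using v that by (simp add: c)
  qed
  then show "Dmul_right mul (- x) x v $ k = v $ k" by (simp add: c S_def)
qed

text \<open>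
  Differentiating \<open>(- p) \<cdot> (p \<cdot> (s w)) = s w\<close> exhibits this map as a right inverse of the one in the previous lemma.
\<close>

lemma unitriangular_left_inv_field: "unitriangular (\<lambda>w. left_inv_field mul w p)"
proof (rule unitriangular_inverse[OF unitriangular_log_derivative[of p]])
  fix w
  have "((\<lambda>s. mul (- p) (mul p (s *\<^sub>R w))) has_vector_derivative
     Dmul_right mul (- p) p (left_inv_field mul w p)) (at 0)"
    using has_vector_derivative_mul_right[where a = "- p", OF has_vector_derivative_mul_right[where a = p, OF has_vector_derivative_ray[of w 0]]]
    by (simp add: left_inv_field_eq)
  then show "Dmul_right mul (- p) p (left_inv_field mul w p) = w"
    using vector_derivative_unique_at[OF _ has_vector_derivative_ray[of w 0]] by simp
qed

text \<open>
  From \<open>a \<cdot> (b + s w) = (a \<cdot> b) \<cdot> ((- b) \<cdot> (b + s w))\<close>, where the second factor passes through the identity.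
\<close>

lemma unitriangular_Dmul_right: "unitriangular (Dmul_right mul a b)"
proof -
  have "Dmul_right mul a b w = left_inv_field mul (Dmul_right mul (- b) b w) (mul a b)" for w
  proof -
    have "((\<lambda>s. mul (mul a b) (mul (- b) (b + s *\<^sub>R w))) has_vector_derivative
       left_inv_field mul (Dmul_right mul (- b) b w) (mul a b)) (at 0)"
      using has_vector_derivative_mul_right[where a = "mul a b", OF has_vector_derivative_mul_right[where a = "- b", OF has_vector_derivative_line[of b w 0]]]
      by (simp add: left_inv_field_eq)
    moreover have "((\<lambda>s. mul a (b + s *\<^sub>R w)) has_vector_derivative Dmul_right mul a b w) (at 0)"
      using has_vector_derivative_mul_right[where a = a, OF has_vector_derivative_line[of b w 0]] by simp
    ultimately show ?thesis by (simp add: mul_assoc vector_derivative_unique_at)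
  qed
  then show ?thesis
    using unitriangular_compose[OF unitriangular_left_inv_field unitriangular_log_derivative] by presburger
qed

text \<open>
  From \<open>(s w) \<cdot> p = p \<cdot> ((- p) \<cdot> (s w) \<cdot> p)\<close>: a right translation is a left translation after a
  conjugation.
\<close>

lemma unitriangular_Dmul_left_0: "unitriangular (Dmul_left mul 0 p)"
proof -
  have "Dmul_left mul 0 p w = Dmul_right mul p 0 (Ad (- p) w)" for w
  proof -
    have "((\<lambda>s. mul p (mul (mul (- p) (s *\<^sub>R w)) (- (- p)))) has_vector_derivative
      Dmul_right mul p 0 (Ad (- p) w)) (at 0)"
      using has_vector_derivative_mul_right[where a = p, OF has_vector_derivative_conjugate[where p = "- p", OF has_vector_derivative_ray[of w 0]]]
      by simp
    moreover have "((\<lambda>s. mul (s *\<^sub>R w) p) has_vector_derivative Dmul_left mul 0 p w) (at 0)"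
      using has_vector_derivative_mul_left[where b = p, OF has_vector_derivative_ray[of w 0]] by simp
    ultimately show ?thesis by (simp add: mul_assoc vector_derivative_unique_at)
  qed
  then show ?thesis
    using unitriangular_compose[OF unitriangular_Dmul_right unitriangular_Ad] by presburger
qed

lemma unitriangular_Dmul_left: "unitriangular (Dmul_left mul a b)"
proof -
  have inv: "unitriangular (Dmul_left mul a (- a))"
  proof (rule unitriangular_inverse[OF unitriangular_Dmul_left_0[of a]])
    fix w
    have "((\<lambda>s. mul (mul (a + s *\<^sub>R w) (- a)) a) has_vector_derivative
       Dmul_left mul 0 a (Dmul_left mul a (- a) w)) (at 0)"
      using has_vector_derivative_mul_left[where b = a, OF has_vector_derivative_mul_left[where b = "- a", OF has_vector_derivative_line[of a w 0]]]
      by simp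
    then show "Dmul_left mul 0 a (Dmul_left mul a (- a) w) = w"
      using vector_derivative_unique_at[OF _ has_vector_derivative_line[of a w 0]] by (simp add: mul_assoc)
  qed
  have "Dmul_left mul a b w = Dmul_left mul 0 (mul a b) (Dmul_left mul a (- a) w)" for w
  proof -
    have "((\<lambda>s. mul (mul (a + s *\<^sub>R w) (- a)) (mul a b)) has_vector_derivative
       Dmul_left mul 0 (mul a b) (Dmul_left mul a (- a) w)) (at 0)"
      using has_vector_derivative_mul_left[where b = "mul a b", OF has_vector_derivative_mul_left[where b = "- a", OF has_vector_derivative_line[of a w 0]]]
      by simp
    moreover have "((\<lambda>s. mul (a + s *\<^sub>R w) b) has_vector_derivative Dmul_left mul a b w) (at 0)"
      using has_vector_derivative_mul_left[where b = b, OF has_vector_derivative_line[of a w 0]] by simp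
    ultimately show ?thesis by (simp add: mul_assoc vector_derivative_unique_at)
  qed
  then show ?thesis
    using unitriangular_compose[OF unitriangular_Dmul_left_0 inv] by presburger
qed

section \<open>Coordinates of left-invariant fields\<close>

lemma linear_left_inv_field: "linear (\<lambda>w. left_inv_field mul w p)"
  using linear_Dmul(2)[of p 0] by (simp add: left_inv_field_eq)

lemma inj_left_inv_field: "inj (\<lambda>w. left_inv_field mul w p)"
  by (rule unitriangular_inj[OF linear_left_inv_field unitriangular_left_inv_field])

lemma component_has_real_derivative:
  assumes "(f has_vector_derivative d) (at s)"
  shows "((\<lambda>s. f s $ k) has_real_derivative d $ k) (at s)"
  using bounded_linear.has_vector_derivative[OF bounded_linear_vec_nth[of k] assms]
  by (simp add: has_real_derivative_iff_has_vector_derivative)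

lemma mul_component_right:
  assumes "\<And>j. j < k \<Longrightarrow> q $ j = 0"
  shows "mul p q $ k = p $ k + q $ k"
proof -
  have "((\<lambda>s. mul p (s *\<^sub>R q) $ k) has_real_derivative q $ k) (at s)" for s
    using component_has_real_derivative[OF has_vector_derivative_mul_right[OF has_vector_derivative_ray[of q s]], of p k]
      unitriangularD[OF unitriangular_Dmul_right, of k q] assms by simp
  from constant_speed[OF this] show ?thesis by simp
qed

lemma mul_component_left:
  assumes "\<And>j. j < k \<Longrightarrow> q $ j = 0"
  shows "mul (p + q) b $ k = mul p b $ k + q $ k"
proof -
  have "((\<lambda>s. mul (p + s *\<^sub>R q) b $ k) has_real_derivative q $ k) (at s)" for s
    using component_has_real_derivative[OF has_vector_derivative_mul_left[OF has_vector_derivative_line[of p q s]], of b k]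
      unitriangularD[OF unitriangular_Dmul_left, of k q] assms by simp
  from constant_speed[OF this] show ?thesis by simp
qed

lemma has_vector_derivative_right_translation:
  "((\<lambda>h. mul p (h *\<^sub>R w)) has_vector_derivative left_inv_field mul w p) (at 0)"
  using has_vector_derivative_mul_right[OF has_vector_derivative_ray[of w 0], of p]
  by (simp add: left_inv_field_eq)

text \<open>
  Moving \<open>p\<close> by \<open>q\<close> changes the \<open>k\<close>-th coordinate of \<open>p \<cdot> (h w)\<close> by the constant \<open>q $ k\<close>, hence does not
  change its \<open>h\<close>-derivative.
\<close>

lemma left_inv_field_component:
  assumes "\<And>j. j < k \<Longrightarrow> q $ j = 0"
  shows "left_inv_field mul w (p + q) $ k = left_inv_field mul w p $ k"
proof -
  have "((\<lambda>h. mul (p + q) (h *\<^sub>R w) $ k) has_real_derivative left_inv_field mul w (p + q) $ k) (at 0)"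
    by (intro component_has_real_derivative has_vector_derivative_right_translation)
  moreover have "((\<lambda>h. mul p (h *\<^sub>R w) $ k + q $ k) has_real_derivative left_inv_field mul w p $ k + 0) (at 0)"
    by (intro DERIV_add component_has_real_derivative has_vector_derivative_right_translation DERIV_const)
  ultimately show ?thesis
    using mul_component_left[OF assms] by (simp add: DERIV_unique)
qed

text \<open>
  The \<open>k\<close>-th component of a left-invariant field does not depend on the \<open>k\<close>-th coordinate.
\<close>

lemma euclidean_divergence_left_inv_field: "euclidean_divergence (left_inv_field mul w) p = 0"
proof -
  have "frechet_derivative (left_inv_field mul w) (at p) (axis k 1) $ k = 0" for k
  proof -
    have "((\<lambda>s. left_inv_field mul w (p + s *\<^sub>R axis k 1)) has_vector_derivative
      frechet_derivative (left_inv_field mul w) (at p) (axis k 1)) (at 0)"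
      using has_derivative_curve[OF has_vector_derivative_line[of p "axis k 1" 0], of "left_inv_field mul w"]
        Ck_1_has_derivative[OF Ck_1_left_inv_field] by simp
    from component_has_real_derivative[OF this, of k]
    have "((\<lambda>s. left_inv_field mul w (p + s *\<^sub>R axis k 1) $ k) has_real_derivative
      frechet_derivative (left_inv_field mul w) (at p) (axis k 1) $ k) (at 0)" .
    moreover have "left_inv_field mul w (p + s *\<^sub>R axis k 1) $ k = left_inv_field mul w p $ k" for s
      by (rule left_inv_field_component) (auto simp: axis_def)
    ultimately show ?thesis using DERIV_unique[OF _ DERIV_const] by simp
  qed
  then show ?thesis by (simp add: euclidean_divergence_def)
qed

end

section \<open>Riemannian and Euclidean divergence\<close>

context sub_finsler_nilpotent_group
begin

lemma metric_at: "g p (left_inv_field mul u p) (left_inv_field mul v p) = g 0 u v"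
  using metric_left_invariant[unfolded left_invariant_metric_def, rule_format, of p 0 u v]
  by (simp add: left_inv_field_def)

text \<open>
  Left translation by \<open>p\<close> is an isometry whose differential at the identity has determinant one, so the
  Gram determinants of the metric at \<open>p\<close> and at the identity agree.
\<close>

lemma volume_density_constant: "volume_density g p = volume_density g 0"
proof -
  let ?G = "\<lambda>p. (\<chi> i j. g p (axis i 1) (axis j 1)) :: ((real, 'n) vec, 'n) vec"
  let ?L = "\<lambda>w. left_inv_field mul w p"
  let ?A = "matrix ?L"
  have bil: "bilinear (g p)" using metric by (simp add: riemannian_metric_def)
  have "?G 0 $ i $ j = (transpose ?A ** ?G p ** ?A) $ i $ j" for i j
  proof -
    have e: "?L (axis i 1) = (\<Sum>a\<in>UNIV. ?A $ a $ i *\<^sub>R axis a 1)" for i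
      using basis_expansion[of "?L (axis i 1)"] by (simp add: scalar_mult_eq_scaleR matrix_def)
    have "?G 0 $ i $ j = g p (?L (axis i 1)) (?L (axis j 1))" by (simp add: metric_at)
    also have "\<dots> = (\<Sum>(a,b)\<in>UNIV\<times>UNIV. g p (?A $ a $ i *\<^sub>R axis a 1) (?A $ b $ j *\<^sub>R axis b 1))"
      unfolding e by (rule bilinear_sum[OF bil])
    also have "\<dots> = (\<Sum>a\<in>UNIV. \<Sum>b\<in>UNIV. ?A $ a $ i * ?A $ b $ j * g p (axis a 1) (axis b 1))"
      by (simp add: sum.cartesian_product bilinear_lmul[OF bil] bilinear_rmul[OF bil] mult_ac)
    also have "\<dots> = (\<Sum>b\<in>UNIV. \<Sum>a\<in>UNIV. ?A $ a $ i * ?A $ b $ j * g p (axis a 1) (axis b 1))"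
      by (rule sum.swap)
    also have "\<dots> = (transpose ?A ** ?G p ** ?A) $ i $ j"
      by (simp add: matrix_matrix_mult_def transpose_def sum_distrib_left sum_distrib_right algebra_simps)
    finally show ?thesis .
  qed
  then have "?G 0 = transpose ?A ** ?G p ** ?A" by (simp add: vec_eq_iff)
  then have "det (?G 0) = det (?G p)"
    by (simp add: det_mul det_transpose det_unitriangular[OF unitriangular_left_inv_field])
  then show ?thesis by (simp add: volume_density_def)
qed

lemma volume_density_nonzero: "volume_density g p \<noteq> 0"
proof -
  let ?G = "(\<chi> i j. g p (axis i 1) (axis j 1)) :: ((real, 'n) vec, 'n) vec"
  have bil: "bilinear (g p)" and pos: "\<And>u. u \<noteq> 0 \<Longrightarrow> 0 < g p u u"
    using metric by (auto simp: riemannian_metric_def)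
  have "u = 0" if "?G *v u = 0" for u
  proof -
    have lin: "linear (g p v)" for v using bil by (simp add: bilinear_def)
    have lin2: "linear (\<lambda>v. g p v u)" using bil by (simp add: bilinear_def)
    have "g p (axis i 1) u = (?G *v u) $ i" for i
      using linear_expand_vec[OF lin, of "axis i 1" u] by (simp add: matrix_vector_mult_def mult.commute)
    then have "g p u u = 0"
      using linear_expand_vec[OF lin2, of u] that by simp
    then show ?thesis using pos[of u] by fastforce
  qed
  then have "det ?G \<noteq> 0"
    by (metis invertible_det_nz invertible_left_inverse matrix_left_invertible_ker)
  then show ?thesis by (simp add: volume_density_def)
qed

lemma divergence_eq:
  assumes "Ck 1 U"
  shows "divergence g U p = euclidean_divergence U p"
proof -
  obtain c where c: "volume_density g = (\<lambda>_. c)" "c \<noteq> 0"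
    using volume_density_constant volume_density_nonzero[of 0] by (metis ext)
  have "frechet_derivative (\<lambda>q. c * U q $ i) (at p) v = c * frechet_derivative U (at p) v $ i" for i v
  proof -
    have "((\<lambda>q. c * U q $ i) has_derivative (\<lambda>v. c * frechet_derivative U (at p) v $ i)) (at p)"
      by (intro has_derivative_mult_right bounded_linear.has_derivative[OF bounded_linear_vec_nth]
          Ck_1_has_derivative assms)
    from frechet_derivative_eq[OF this] show ?thesis by simp
  qed
  then have "divergence g U p = (\<Sum>i\<in>UNIV. c * frechet_derivative U (at p) (axis i 1) $ i) / c"
    by (simp add: divergence_def c)
  then show ?thesis
    using c(2) by (simp add: euclidean_divergence_def sum_distrib_left[symmetric])
qed

section \<open>Horizontal vectors and test fields\<close>

lemma X_eq: "i < k \<Longrightarrow> X i p = left_inv_field mul (X i 0) p"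
  using X_left_invariant[of i] unfolding left_invariant_def left_inv_field_def
  by (metis mul_0(2))

lemma horizontal_eq: "horizontal k X p = (\<lambda>u. left_inv_field mul u p) ` horizontal k X 0"
proof -
  have "{X i p |i. i < k} = (\<lambda>u. left_inv_field mul u p) ` {X i 0 |i. i < k}"
    using X_eq[of _ p] by (auto simp: image_iff) metis
  then show ?thesis
    unfolding horizontal_def by (simp only: linear_span_image[OF linear_left_inv_field])
qed

lemma horizontal_combination:
  assumes "u \<in> horizontal k X p"
  shows "\<exists>a. u = (\<Sum>i<k. a i *\<^sub>R X i p)"
proof -
  let ?S = "range (\<lambda>a. \<Sum>i<k. a i *\<^sub>R X i p)"
  have "horizontal k X p \<subseteq> ?S"
    unfolding horizontal_def
  proof (rule span_minimal)
    show "{X i p |i. i < k} \<subseteq> ?S"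
    proof clarify
      fix i assume "i < k"
      then have "X i p = (\<Sum>j<k. (if j = i then 1 else 0) *\<^sub>R X j p)"
        by (simp add: if_distrib[of "\<lambda>a. a *\<^sub>R _"] cong: if_cong)
      then show "X i p \<in> ?S" by (rule image_eqI[where x = "\<lambda>j. if j = i then 1 else 0"]) simp
    qed
    show "subspace ?S"
      unfolding subspace_def
    proof (intro conjI ballI allI)
      show "0 \<in> ?S" by (rule image_eqI[of _ _ "\<lambda>_. 0"]) auto
      show "x + y \<in> ?S" if "x \<in> ?S" "y \<in> ?S" for x y
      proof -
        from that obtain a b where "x = (\<Sum>i<k. a i *\<^sub>R X i p)" "y = (\<Sum>i<k. b i *\<^sub>R X i p)" by auto
        then have "x + y = (\<Sum>i<k. (a i + b i) *\<^sub>R X i p)" by (simp add: scaleR_add_left sum.distrib)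
        then show ?thesis by (rule image_eqI[where x = "\<lambda>i. a i + b i"]) simp
      qed
      show "c *\<^sub>R x \<in> ?S" if "x \<in> ?S" for c x
      proof -
        from that obtain a where "x = (\<Sum>i<k. a i *\<^sub>R X i p)" by auto
        then have "c *\<^sub>R x = (\<Sum>i<k. (c * a i) *\<^sub>R X i p)" by (simp add: scaleR_sum_right)
        then show ?thesis by (rule image_eqI[where x = "\<lambda>i. c * a i"]) simp
      qed
    qed
  qed
  then show ?thesis using assms by auto
qed

text \<open>
  Whatever coefficients the choice in \<^term>\<open>asym_norm_at\<close> returns, the injective differential of the left
  translation transports the combination back to \<open>u\<close>.
\<close>

lemma asym_norm_at_eq:
  assumes "u \<in> horizontal k X 0"
  shows "asym_norm_at k X K p (left_inv_field mul u p) = asym_norm K u"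
proof -
  define a where "a = (SOME a. left_inv_field mul u p = (\<Sum>i<k. a i *\<^sub>R X i p))"
  have "\<exists>a. left_inv_field mul u p = (\<Sum>i<k. a i *\<^sub>R X i p)"
    using assms horizontal_eq[of p] by (intro horizontal_combination) auto
  then have "left_inv_field mul u p = (\<Sum>i<k. a i *\<^sub>R X i p)"
    unfolding a_def by (rule someI_ex)
  also have "\<dots> = (\<Sum>i<k. a i *\<^sub>R left_inv_field mul (X i 0) p)"
    by (intro sum.cong refl) (use X_eq[of _ p] in auto)
  also have "\<dots> = left_inv_field mul (\<Sum>i<k. a i *\<^sub>R X i 0) p"
    by (simp add: linear_sum[OF linear_left_inv_field] linear_scale[OF linear_left_inv_field])
  finally have "u = (\<Sum>i<k. a i *\<^sub>R X i 0)"
    using inj_left_inv_field[of p] by (simp add: inj_def)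
  then have "asym_norm K u = asym_norm K (\<Sum>i<k. a i *\<^sub>R X i 0)" by (rule arg_cong)
  then show ?thesis by (simp only: asym_norm_at_def a_def Let_def)
qed

lemma K_absorbs:
  obtains e where "e > 0" "\<And>u. u \<in> horizontal k X 0 \<Longrightarrow> norm u \<le> e \<Longrightarrow> u \<in> K"
proof -
  obtain T where T: "openin (top_of_set (horizontal k X 0)) T" "0 \<in> T" "T \<subseteq> K"
    using K_interior by (auto simp: interior_of_def)
  then obtain e where e: "e > 0" "ball 0 e \<inter> horizontal k X 0 \<subseteq> T"
    by (auto simp: openin_contains_ball)
  show ?thesis
  proof (rule that[of "e / 2"])
    fix u assume "u \<in> horizontal k X 0" "norm u \<le> e / 2"
    then have "u \<in> ball 0 e \<inter> horizontal k X 0" using e(1) by simp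
    then show "u \<in> K" using e(2) T(3) by blast
  qed (use e in simp)
qed

lemma zero_in_K: "0 \<in> K"
proof -
  obtain e where e: "e > 0" "\<And>u. u \<in> horizontal k X 0 \<Longrightarrow> norm u \<le> e \<Longrightarrow> u \<in> K"
    using K_absorbs by blast
  show ?thesis by (rule e(2)) (use e(1) in \<open>simp_all add: horizontal_def span_zero\<close>)
qed

text \<open>
  If the gauge of \<open>u\<close> is at most \<open>1\<close> then \<open>u / (1 + 1 / (m + 1))\<close> lies in \<open>K\<close> for every \<open>m\<close>, because \<open>K\<close> is convex and
  contains \<open>0\<close>; let \<open>m\<close> tend to infinity, as \<open>K\<close> is closed. The infimum is over a nonempty set because \<open>K\<close> absorbs
  horizontal vectors.
\<close>

lemma asym_norm_le_1_iff:
  assumes u: "u \<in> horizontal k X 0"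
  shows "asym_norm K u \<le> 1 \<longleftrightarrow> u \<in> K"
proof
  let ?S = "{l. 0 \<le> l \<and> u \<in> (\<lambda>x. l *\<^sub>R x) ` K}"
  have bdd: "bdd_below ?S" by (auto intro: bdd_belowI)
  show "asym_norm K u \<le> 1" if "u \<in> K"
    unfolding asym_norm_def by (rule cInf_lower[OF _ bdd]) (use that in auto)
  assume le: "asym_norm K u \<le> 1"
  \<comment> \<open>The infimum of the empty set of reals carries no information.\<close>
  have ne: "?S \<noteq> {}"
  proof -
    obtain e where e: "e > 0" "\<And>u. u \<in> horizontal k X 0 \<Longrightarrow> norm u \<le> e \<Longrightarrow> u \<in> K"
      using K_absorbs by blast
    let ?l = "norm u / e + 1"
    have l: "?l > 0" using e(1) by (simp add: add_nonneg_pos)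
    have "norm (inverse ?l *\<^sub>R u) \<le> e"
      using e(1) l by (simp add: field_simps)
    then have "inverse ?l *\<^sub>R u \<in> K"
      using u by (intro e) (simp_all add: horizontal_def span_scale)
    then have "u \<in> (\<lambda>x. ?l *\<^sub>R x) ` K"
      using l by (intro image_eqI[of _ _ "inverse ?l *\<^sub>R u"]) simp_all
    then show ?thesis using l by (auto intro: less_imp_le)
  qed
  have K: "inverse (1 + 1 / real (Suc m)) *\<^sub>R u \<in> K" for m
  proof -
    have "Inf ?S < 1 + 1 / real (Suc m)"
      using le by (simp add: asym_norm_def add_pos_pos order_le_less_trans)
    then obtain l where l: "0 \<le> l" "u \<in> (\<lambda>x. l *\<^sub>R x) ` K" "l < 1 + 1 / real (Suc m)"
      using cInf_lessD[OF ne] by blast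
    then obtain x where x: "x \<in> K" "u = l *\<^sub>R x" by blast
    let ?c = "inverse (1 + 1 / real (Suc m)) * l"
    have "0 \<le> ?c" "?c \<le> 1" using l by (simp_all add: field_simps)
    then have "?c *\<^sub>R x + (1 - ?c) *\<^sub>R 0 \<in> K"
      by (intro convexD[OF K_convex x(1) zero_in_K]) simp_all
    then show ?thesis using x(2) by simp
  qed
  have "(\<lambda>m. inverse (1 + 1 / real (Suc m)) *\<^sub>R u) \<longlonglongrightarrow> inverse (1 + 0) *\<^sub>R u"
    by (intro tendsto_intros LIMSEQ_Suc[OF lim_1_over_n]) simp
  then show "u \<in> K"
    using closed_sequentially[OF compact_imp_closed[OF K_compact] K] by simp
qed

text \<open>
  In this form, membership in the convex body can be checked for convex combinations of fields.
\<close>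

lemma test_field_iff:
  "test_field k X K U \<longleftrightarrow>
     Ck 1 U \<and> bounded {p. U p \<noteq> 0} \<and> (\<forall>p. \<exists>u\<in>K. U p = left_inv_field mul u p)"
proof -
  have "U p \<in> horizontal k X p \<and> asym_norm_at k X K p (U p) \<le> 1 \<longleftrightarrow>
    (\<exists>u\<in>K. U p = left_inv_field mul u p)" for p
    using asym_norm_at_eq[of _ p] asym_norm_le_1_iff K_subset by (auto simp: horizontal_eq[of p])
  then show ?thesis unfolding test_field_def by (auto simp del: One_nat_def)
qed

section \<open>A calibration of the half-spaces\<close>

lemma not_less_Min_UNIV: "\<not> (j :: 'n) < Min UNIV"
  by (simp only: not_less) (rule Min_le, simp_all)

text \<open>
  No coordinate precedes the first one, so triangularity makes it a homomorphism to the additive reals.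
\<close>

lemma first_coordinate_mul: "mul p q $ Min UNIV = p $ Min UNIV + q $ Min UNIV"
  by (rule mul_component_right) (use not_less_Min_UNIV in blast)

lemma first_coordinate_left_inv_field: "left_inv_field mul w p $ Min UNIV = w $ Min UNIV"
  by (rule unitriangularD[OF unitriangular_left_inv_field]) (use not_less_Min_UNIV in blast)

text \<open>
  The first coordinate annihilates all Lie brackets. If it also annihilated the horizontal vectors it would
  annihilate the whole filtration, against the bracket generating condition; so it takes positive values
  on \<open>K\<close>, which is a neighbourhood of \<open>0\<close> in the horizontal space.
\<close>

lemma calibrating_direction:
  obtains n where "n \<in> K" "\<And>u. u \<in> K \<Longrightarrow> u $ Min UNIV \<le> n $ Min UNIV" "0 < n $ Min UNIV"
proof -
  let ?i = "Min (UNIV :: 'n set)"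
  have "continuous_on K (\<lambda>u. u $ ?i)" by (intro continuous_intros)
  then obtain n where n: "n \<in> K" "\<And>u. u \<in> K \<Longrightarrow> u $ ?i \<le> n $ ?i"
    using continuous_attains_sup[OF K_compact] zero_in_K by blast
  obtain e where e: "e > 0" "\<And>u. u \<in> horizontal k X 0 \<Longrightarrow> norm u \<le> e \<Longrightarrow> u \<in> K"
    using K_absorbs by blast
  have "\<exists>u\<in>horizontal k X 0. u $ ?i \<noteq> 0"
  proof (rule ccontr)
    assume "\<not> (\<exists>u\<in>horizontal k X 0. u $ ?i \<noteq> 0)"
    then have H: "horizontal k X 0 \<subseteq> {u. u $ ?i = 0}" by auto
    have sub: "subspace {u :: (real, 'n) vec. u $ ?i = 0}" by (simp add: subspace_def)
    have br: "lie_bracket mul u w $ ?i = 0" for u w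
      by (rule lie_bracket_strictly_triangular) (use not_less_Min_UNIV in blast)
    have "horizontal_filtration mul k X s \<subseteq> {u. u $ ?i = 0}" for s
    proof (induction s)
      case (Suc s)
      show ?case unfolding horizontal_filtration.simps
        by (rule span_minimal[OF _ sub]) (use Suc br in auto)
    qed (use H in auto)
    moreover have "axis ?i 1 \<notin> {u :: (real, 'n) vec. u $ ?i = 0}" by simp
    ultimately show False using X_generating unfolding bracket_generating_def by blast
  qed
  then obtain u where u: "u \<in> horizontal k X 0" "u $ ?i \<noteq> 0" by blast
  let ?c = "sgn (u $ ?i) * e / norm u"
  have "norm u \<noteq> 0" using u(2) by auto
  then have "norm (?c *\<^sub>R u) \<le> e" using e(1) u(2) by (simp add: abs_mult)
  then have "?c *\<^sub>R u \<in> K" using u(1) by (intro e) (simp_all add: horizontal_def span_scale)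
  moreover have "0 < (?c *\<^sub>R u) $ ?i"
    using u(2) \<open>norm u \<noteq> 0\<close> e(1) by (auto simp: sgn_if zero_less_divide_iff mult_less_0_iff zero_less_mult_iff)
  ultimately have "0 < n $ ?i" using n(2) by fastforce
  then show ?thesis using that n by blast
qed

lemma compactly_supported_divergence:
  assumes "test_field k X K U"
  shows "continuous_on UNIV (euclidean_divergence U)"
    and "\<exists>S. compact S \<and> (\<forall>p. p \<notin> S \<longrightarrow> euclidean_divergence U p = 0)"
proof -
  have U: "Ck 1 U" "compact (closure {p. U p \<noteq> 0})"
    using assms unfolding test_field_def by blast+
  show "continuous_on UNIV (euclidean_divergence U)"
    by (rule continuous_euclidean_divergence[OF U(1)])
  show "\<exists>S. compact S \<and> (\<forall>p. p \<notin> S \<longrightarrow> euclidean_divergence U p = 0)"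
    using U(2) euclidean_divergence_outside_support[of _ U] by blast
qed

text \<open>
  The test fields that carry the comparison. Let \<open>\<lambda>\<close> be the first coordinate, \<open>n\<close> a maximiser of \<open>\<lambda>\<close> on \<open>K\<close>,
  \<open>c = \<lambda> n\<close>, and \<open>N\<close> the left-invariant field through \<open>n\<close>. Then \<open>W = \<phi> U + (1 - \<phi>) \<psi> N\<close> takes its values in the translates of
  \<open>K\<close> by convexity, where \<open>\<phi>\<close> is a decreasing function of \<open>\<lambda>\<close> that approximates the indicator of \<open>{\<lambda> < t}\<close> from below, and
  \<open>\<psi>\<close> is a cutoff. As \<open>N\<close> is divergence free,
  \<open>div W = \<phi> div U + \<bar>\<phi>'\<bar> (c \<psi> - \<lambda> U) + (1 - \<phi>) N \<psi>\<close>, with \<open>\<phi>'\<close> the derivative of \<open>\<phi>\<close> with respect to \<open>\<lambda>\<close>. The middle term is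
  nonnegative when \<open>\<psi> = 1\<close> on the support of \<open>U\<close>, since \<open>\<lambda> U \<le> c\<close>.
  
  The coefficients of \<open>N\<close> may be unbounded, so \<open>\<psi>\<close> is adapted to the flow of \<open>N\<close>, which consists of the right
  translations by \<open>h n\<close>: it is the product of a function of \<open>\<lambda> / T\<close> and a function of \<open>\<pi>\<close>, where \<open>\<pi>\<close> slides a point along
  the flow to the hyperplane \<open>\<lambda> = 0\<close>. Only the first factor varies along the flow, hence \<open>N \<psi>\<close> is of order \<open>1 / T\<close>
  uniformly.
\<close>

lemma truncated_test_field:
  fixes t :: real
  assumes U: "test_field k X K U"
  obtains \<phi> :: "nat \<Rightarrow> (real, 'n) vec \<Rightarrow> real" and W :: "nat \<Rightarrow> (real, 'n) vec \<Rightarrow> (real, 'n) vec" and C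
  where "\<And>j. test_field k X K (W j)" "\<And>j. continuous_on UNIV (\<phi> j)"
    "\<And>j p. 0 \<le> \<phi> j p" "\<And>j p. \<phi> j p \<le> 1"
    "\<And>p. (\<lambda>j. \<phi> j p) \<longlonglongrightarrow> indicator {p. p $ Min UNIV < t} p"
    "\<forall>\<^sub>F j in sequentially. \<forall>p. \<phi> j p * euclidean_divergence U p - C / real (Suc j) \<le> euclidean_divergence (W j) p"
proof -
  let ?i = "Min (UNIV :: 'n set)"
  obtain s s' :: "real \<Rightarrow> real"
  where s: "\<And>x. (s has_real_derivative s' x) (at x)" "continuous_on UNIV s'" "\<And>x. 0 \<le> s' x"
    "\<And>x. 0 \<le> s x" "\<And>x. s x \<le> 1" "\<And>x. x \<le> 0 \<Longrightarrow> s x = 0" "\<And>x. x \<le> 0 \<Longrightarrow> s' x = 0"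
    "\<And>x. 1 \<le> x \<Longrightarrow> s x = 1"
    using C1_step_function by blast
  obtain a a' :: "real \<Rightarrow> real" and M :: real
  where a: "\<And>x. (a has_real_derivative a' x) (at x)" "continuous_on UNIV a'" "\<And>x. \<bar>a' x\<bar> \<le> M"
    "\<And>x. 0 \<le> a x" "\<And>x. a x \<le> 1" "\<And>x. \<bar>x\<bar> \<le> 1 \<Longrightarrow> a x = 1" "\<And>x. 2 \<le> \<bar>x\<bar> \<Longrightarrow> a x = 0"
    using C1_bump_function by blast
  obtain n where n: "n \<in> K" "\<And>u. u \<in> K \<Longrightarrow> u $ ?i \<le> n $ ?i" "0 < n $ ?i"
    using calibrating_direction by blast
  define c where "c = n $ ?i"
  have c: "c > 0" using n(3) by (simp add: c_def)
  define N where "N = left_inv_field mul n"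
  have N: "Ck 1 N" unfolding N_def by (rule Ck_1_left_inv_field)
  define S where "S = closure {p. U p \<noteq> 0}"
  have U1: "Ck 1 U" and S: "compact S" and UK: "\<And>p. \<exists>u\<in>K. U p = left_inv_field mul u p"
    using U unfolding test_field_iff S_def by simp_all
  have US: "U p = 0" if "p \<notin> S" for p
    using that closure_subset[of "{p. U p \<noteq> 0}"] by (auto simp: S_def)
  define \<pi> where "\<pi> p = mul p ((- p $ ?i / c) *\<^sub>R n)" for p
  have \<pi>: "Ck 1 \<pi>"
  proof -
    have "bounded_linear (\<lambda>p :: (real, 'n) vec. (p, (- p $ ?i / c) *\<^sub>R n))"
      by (intro bounded_linear_Pair bounded_linear_ident bounded_linear_compose[OF bounded_linear_scaleR_left]
          bounded_linear_divide[THEN bounded_linear_compose] bounded_linear_minus bounded_linear_vec_nth)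
    from Ck_1_compose[OF Ck_1_mul Ck_1_bounded_linear[OF this]] show ?thesis
      by (simp add: \<pi>_def[abs_def] del: One_nat_def)
  qed
  have \<pi>_flow: "\<pi> (mul p (h *\<^sub>R n)) = \<pi> p" for p h
  proof -
    have "(- (mul p (h *\<^sub>R n)) $ ?i / c) = - h + (- p $ ?i / c)"
      using c by (simp add: first_coordinate_mul c_def field_simps)
    then have "\<pi> (mul p (h *\<^sub>R n)) = mul p (mul (h *\<^sub>R n) ((- h + (- p $ ?i / c)) *\<^sub>R n))"
      unfolding \<pi>_def mul_assoc by (simp only:)
    then show ?thesis by (simp only: exp_coords \<pi>_def) simp
  qed
  have \<pi>_inverse: "p = mul (\<pi> p) ((p $ ?i / c) *\<^sub>R n)" for p
    by (simp add: \<pi>_def mul_assoc exp_coords)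
  have \<pi>S: "compact (\<pi> ` S)"
    by (rule compact_continuous_image[OF Ck_1_continuous[OF \<pi>] S])
  obtain \<beta> :: "(real, 'n) vec \<Rightarrow> real" and R
  where \<beta>: "Ck 1 \<beta>" "\<And>x. 0 \<le> \<beta> x" "\<And>x. \<beta> x \<le> 1" "\<And>x. x \<in> \<pi> ` S \<Longrightarrow> \<beta> x = 1" "\<And>x. \<beta> x \<noteq> 0 \<Longrightarrow> norm x \<le> R"
    using C1_cutoff[OF \<pi>S] by metis
  define T where "T j = real (Suc j)" for j
  have T: "T j > 0" for j by (simp add: T_def)
  define \<phi> where "\<phi> j p = s ((t - p $ ?i) * T j)" for j p
  define \<psi> where "\<psi> j p = a (p $ ?i / T j) * \<beta> (\<pi> p)" for j p
  define \<kappa> where "\<kappa> j p = (1 - \<phi> j p) * \<psi> j p" for j p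
  define W where "W j p = \<phi> j p *\<^sub>R U p + \<kappa> j p *\<^sub>R N p" for j p
  have \<phi>: "0 \<le> \<phi> j p" "\<phi> j p \<le> 1" for j p using s by (simp_all add: \<phi>_def)
  have \<psi>: "0 \<le> \<psi> j p" "\<psi> j p \<le> 1" for j p
    using a(4,5)[of "p $ ?i / T j"] \<beta>(2,3)[of "\<pi> p"] by (simp_all add: \<psi>_def mult_le_one)
  have affine: "Ck 1 (\<lambda>p :: (real, 'n) vec. p $ ?i * x)" for x
    by (rule Ck_1_bounded_linear[OF bounded_linear_compose[OF bounded_linear_mult_left bounded_linear_vec_nth]])
  have "Ck 1 (\<lambda>p :: (real, 'n) vec. t * T j + p $ ?i * (- T j))" for j
    by (intro Ck_1_add Ck_1_const affine)
  from Ck_1_compose[OF Ck_1_real[OF s(1,2)] this] have \<phi>1: "Ck 1 (\<phi> j)" for j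
    by (simp add: \<phi>_def[abs_def] algebra_simps del: One_nat_def)
  have "Ck 1 (\<lambda>p. a (p $ ?i * (1 / T j)) *\<^sub>R \<beta> (\<pi> p))" for j
    by (intro Ck_1_scaleR Ck_1_compose[OF Ck_1_real[OF a(1,2)] affine] Ck_1_compose[OF \<beta>(1) \<pi>])
  then have \<psi>1: "Ck 1 (\<psi> j)" for j
    by (simp add: \<psi>_def[abs_def] del: One_nat_def)
  have "Ck 1 (\<lambda>p. (1 + (-1) *\<^sub>R \<phi> j p) *\<^sub>R \<psi> j p)" for j
    by (intro Ck_1_scaleR Ck_1_add Ck_1_const \<phi>1 \<psi>1)
  then have \<kappa>1: "Ck 1 (\<kappa> j)" for j
    by (simp add: \<kappa>_def[abs_def] del: One_nat_def)
  have W1: "Ck 1 (W j)" for j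
    unfolding W_def[abs_def] by (intro Ck_1_add Ck_1_scaleR \<phi>1 \<kappa>1 U1 N)
  \<comment> \<open>A convex combination of \<open>u\<close>, \<open>n\<close> and \<open>0\<close> with weights \<open>\<phi>\<close>, \<open>(1 - \<phi>) \<psi>\<close> and \<open>(1 - \<phi>) (1 - \<psi>)\<close>.\<close>
  have W_K: "\<exists>u\<in>K. W j p = left_inv_field mul u p" for j p
  proof -
    obtain u where u: "u \<in> K" "U p = left_inv_field mul u p" using UK by blast
    have "\<psi> j p *\<^sub>R n + (1 - \<psi> j p) *\<^sub>R 0 \<in> K"
      using \<psi>[of j p] by (intro convexD[OF K_convex n(1) zero_in_K]) simp_all
    then have "\<phi> j p *\<^sub>R u + (1 - \<phi> j p) *\<^sub>R (\<psi> j p *\<^sub>R n) \<in> K"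
      using \<phi>[of j p] by (intro convexD[OF K_convex u(1)]) simp_all
    moreover have "W j p = left_inv_field mul (\<phi> j p *\<^sub>R u + (1 - \<phi> j p) *\<^sub>R (\<psi> j p *\<^sub>R n)) p"
      by (simp add: W_def u(2) N_def \<kappa>_def linear_add[OF linear_left_inv_field] linear_scale[OF linear_left_inv_field])
    ultimately show ?thesis by blast
  qed
  \<comment> \<open>A point with \<open>\<psi> \<noteq> 0\<close> is reached from a bounded set by a right translation of bounded length.\<close>
  have W_bounded: "bounded {p. W j p \<noteq> 0}" for j
  proof -
    let ?P = "(\<lambda>z. mul (fst z) (snd z)) ` ((\<lambda>(x, \<tau>). (x, (\<tau> / c) *\<^sub>R n)) ` (cball 0 R \<times> {- (2 * T j)..2 * T j}))"
    have "compact ?P"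
      by (intro compact_continuous_image Ck_1_continuous[OF Ck_1_mul] compact_Times compact_cball compact_Icc)
         (use c in \<open>auto intro!: continuous_intros simp: case_prod_unfold\<close>)
    then have b: "bounded (S \<union> ?P)" using S by (auto intro: compact_imp_bounded)
    have "p \<in> ?P" if "\<psi> j p \<noteq> 0" for p
    proof -
      have "norm (\<pi> p) \<le> R" using that \<beta>(5) by (auto simp: \<psi>_def)
      moreover have "\<bar>p $ ?i / T j\<bar> < 2"
        using that a(7)[of "p $ ?i / T j"] by (auto simp: \<psi>_def not_le[symmetric])
      then have "\<bar>p $ ?i\<bar> < 2 * T j" using T[of j] by (simp add: field_simps)
      ultimately show ?thesis
        using \<pi>_inverse[of p] by (intro image_eqI[where x = "(\<pi> p, (p $ ?i / c) *\<^sub>R n)"] image_eqI[where x = "(\<pi> p, p $ ?i)"]) auto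
    qed
    moreover have "p \<in> S \<or> \<psi> j p \<noteq> 0" if "W j p \<noteq> 0" for p
      using that US[of p] by (auto simp: W_def \<kappa>_def)
    ultimately have "{p. W j p \<noteq> 0} \<subseteq> S \<union> ?P" by blast
    then show ?thesis by (rule bounded_subset[OF b])
  qed
  have test: "test_field k X K (W j)" for j
    unfolding test_field_iff using W1 W_bounded W_K by blast
  have D\<phi>: "frechet_derivative (\<phi> j) (at p) u = - T j * s' ((t - p $ ?i) * T j) * u $ ?i" for j p u
  proof -
    have "((\<lambda>p. (t - p $ ?i) * T j) has_derivative (\<lambda>u. (0 - u $ ?i) * T j)) (at p)"
      by (intro has_derivative_mult_left has_derivative_diff has_derivative_const
          bounded_linear.has_derivative[OF bounded_linear_vec_nth] has_derivative_ident)
    from has_derivative_compose[OF this s(1)[unfolded has_field_derivative_def]]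
    have "(\<phi> j has_derivative (\<lambda>u. s' ((t - p $ ?i) * T j) * ((0 - u $ ?i) * T j))) (at p)"
      by (simp add: \<phi>_def[abs_def])
    from frechet_derivative_eq[OF this] show ?thesis by simp
  qed
  \<comment> \<open>Differentiate along the integral curve \<open>h \<mapsto> p \<cdot> (h n)\<close> of \<open>N\<close>, on which \<open>\<pi>\<close> is constant and \<open>\<lambda>\<close> is affine.\<close>
  have D\<kappa>: "frechet_derivative (\<kappa> j) (at p) (N p) =
     c * T j * s' ((t - p $ ?i) * T j) * \<psi> j p + (1 - \<phi> j p) * (c / T j) * a' (p $ ?i / T j) * \<beta> (\<pi> p)" for j p
  proof -
    have "((\<lambda>h. \<kappa> j (mul p (h *\<^sub>R n))) has_vector_derivative frechet_derivative (\<kappa> j) (at p) (N p)) (at 0)"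
      using has_derivative_curve[OF has_vector_derivative_right_translation[of p n], of "\<kappa> j"] Ck_1_has_derivative[OF \<kappa>1, of j p]
      by (simp add: N_def)
    moreover have "\<kappa> j (mul p (h *\<^sub>R n)) = (1 - s ((t - (p $ ?i + h * c)) * T j)) * (a ((p $ ?i + h * c) / T j) * \<beta> (\<pi> p))" for h
      by (simp add: \<kappa>_def \<phi>_def \<psi>_def first_coordinate_mul \<pi>_flow c_def)
    ultimately have 1: "((\<lambda>h. (1 - s ((t - (p $ ?i + h * c)) * T j)) * (a ((p $ ?i + h * c) / T j) * \<beta> (\<pi> p)))
      has_real_derivative frechet_derivative (\<kappa> j) (at p) (N p)) (at 0)"
      by (simp add: has_real_derivative_iff_has_vector_derivative)
    have s0: "((\<lambda>h. s ((t - (p $ ?i + h * c)) * T j)) has_real_derivative s' ((t - p $ ?i) * T j) * (- c * T j)) (at 0)"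
      by (rule DERIV_chain'[where g = s, OF _ s(1), THEN DERIV_cong]) (auto intro!: derivative_eq_intros)
    have a0: "((\<lambda>h. a ((p $ ?i + h * c) / T j)) has_real_derivative a' (p $ ?i / T j) * (c / T j)) (at 0)"
      by (rule DERIV_chain'[where g = a, OF _ a(1), THEN DERIV_cong]) (use T[of j] in \<open>auto intro!: derivative_eq_intros\<close>)
    have "((\<lambda>h. (1 - s ((t - (p $ ?i + h * c)) * T j)) * (a ((p $ ?i + h * c) / T j) * \<beta> (\<pi> p)))
      has_real_derivative (c * T j * s' ((t - p $ ?i) * T j) * \<psi> j p + (1 - \<phi> j p) * (c / T j) * a' (p $ ?i / T j) * \<beta> (\<pi> p))) (at 0)"
      by (rule derivative_eq_intros s0 a0 refl)+ (simp add: \<phi>_def \<psi>_def algebra_simps diff_divide_distrib)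
    from DERIV_unique[OF 1 this] show ?thesis .
  qed
  have divW: "euclidean_divergence (W j) p = \<phi> j p * euclidean_divergence U p +
     T j * s' ((t - p $ ?i) * T j) * (c * \<psi> j p - U p $ ?i) +
     (1 - \<phi> j p) * (c / T j) * a' (p $ ?i / T j) * \<beta> (\<pi> p)" for j p
  proof -
    have "euclidean_divergence (W j) p = (\<phi> j p * euclidean_divergence U p + frechet_derivative (\<phi> j) (at p) (U p)) +
       (\<kappa> j p * euclidean_divergence N p + frechet_derivative (\<kappa> j) (at p) (N p))"
      unfolding W_def[abs_def]
      by (simp only: euclidean_divergence_add[OF Ck_1_scaleR[OF \<phi>1 U1] Ck_1_scaleR[OF \<kappa>1 N]]
          euclidean_divergence_scaleR[OF \<phi>1 U1] euclidean_divergence_scaleR[OF \<kappa>1 N])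
    then show ?thesis
      unfolding D\<phi> D\<kappa> by (simp add: N_def euclidean_divergence_left_inv_field algebra_simps)
  qed
  have "bounded ((\<lambda>p. p $ ?i) ` S)"
    by (rule bounded_linear_image[OF compact_imp_bounded[OF S] bounded_linear_vec_nth])
  then obtain b where b: "\<And>p. p \<in> S \<Longrightarrow> \<bar>p $ ?i\<bar> \<le> b" by (auto simp: bounded_iff)
  have T_eventually: "\<forall>\<^sub>F j in sequentially. x \<le> T j" for x
  proof (rule eventually_sequentiallyI)
    show "x \<le> T j" if "nat \<lceil>x\<rceil> \<le> j" for j
      using that unfolding T_def by linarith
  qed
  from this[of b]
  have "\<forall>\<^sub>F j in sequentially. \<forall>p. \<phi> j p * euclidean_divergence U p - c * M / real (Suc j) \<le> euclidean_divergence (W j) p"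
  proof (rule eventually_mono, intro allI)
    fix j p assume bT: "b \<le> T j"
    have "0 \<le> c * \<psi> j p - U p $ ?i"
    proof (cases "p \<in> S")
      case True
      then have "\<bar>p $ ?i / T j\<bar> \<le> 1" using b[OF True] bT T[of j] by (simp add: field_simps)
      then have "\<psi> j p = 1" using a(6) \<beta>(4) True by (simp add: \<psi>_def)
      moreover obtain u where "u \<in> K" "U p = left_inv_field mul u p" using UK by blast
      ultimately show ?thesis using n(2)[of u] by (simp add: first_coordinate_left_inv_field c_def)
    next
      case False
      then show ?thesis using US c \<psi>[of j p] by simp
    qed
    then have 1: "0 \<le> T j * s' ((t - p $ ?i) * T j) * (c * \<psi> j p - U p $ ?i)"
      using s(3) T[of j] by (simp add: less_imp_le)
    have "\<bar>(1 - \<phi> j p) * (c / T j) * a' (p $ ?i / T j) * \<beta> (\<pi> p)\<bar> =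
      ((1 - \<phi> j p) * \<beta> (\<pi> p)) * ((c / T j) * \<bar>a' (p $ ?i / T j)\<bar>)"
      using \<phi>[of j p] \<beta>(2)[of "\<pi> p"] c T[of j] by (simp add: abs_mult)
    also have "\<dots> \<le> 1 * ((c / T j) * M)"
    proof (rule mult_mono)
      show "(1 - \<phi> j p) * \<beta> (\<pi> p) \<le> 1"
        using \<phi>[of j p] \<beta>(2,3)[of "\<pi> p"] by (intro mult_le_one) simp_all
      show "(c / T j) * \<bar>a' (p $ ?i / T j)\<bar> \<le> (c / T j) * M"
        using a(3) c T[of j] by (intro mult_left_mono) (simp_all add: less_imp_le)
    qed (use c T[of j] in \<open>simp_all add: less_imp_le\<close>)
    finally have 2: "\<bar>(1 - \<phi> j p) * (c / T j) * a' (p $ ?i / T j) * \<beta> (\<pi> p)\<bar> \<le> c * M / real (Suc j)"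
      by (simp add: T_def)
    have "x - e \<le> x + y + z" if "0 \<le> y" "\<bar>z\<bar> \<le> e" for x y z e :: real
      using that by linarith
    from this[OF 1 2] show "\<phi> j p * euclidean_divergence U p - c * M / real (Suc j) \<le> euclidean_divergence (W j) p"
      unfolding divW .
  qed
  moreover have "(\<lambda>j. \<phi> j p) \<longlonglongrightarrow> indicator {p. p $ ?i < t} p" for p
  proof (cases "p $ ?i < t")
    case True
    then have "\<forall>\<^sub>F j in sequentially. 1 \<le> (t - p $ ?i) * T j"
      using T_eventually[of "1 / (t - p $ ?i)"] by (simp add: field_simps)
    then have "\<forall>\<^sub>F j in sequentially. \<phi> j p = 1"
      by (rule eventually_mono) (simp add: \<phi>_def s(8))
    then show ?thesis using True by (simp add: tendsto_eventually)
  next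
    case False
    then have "\<phi> j p = 0" for j
      unfolding \<phi>_def using T[of j] by (intro s(6)) (simp add: mult_le_0_iff)
    then show ?thesis using False by simp
  qed
  ultimately show ?thesis
    using that[of W \<phi> "c * M"] test \<phi> Ck_1_continuous[OF \<phi>1] by blast
qed

end

section \<open>Truncation by half-spaces\<close>

lemma half_space_measurable: "{p :: real^'n. p $ i < t} \<in> sets lebesgue"
proof -
  have "open {p :: real^'n. p $ i < t}"
    by (intro open_Collect_less continuous_intros)
  then show ?thesis by (intro sets_completionI_sets) (simp add: borel_open)
qed

context sub_finsler_nilpotent_group
begin

text \<open>
  Test \<open>E\<close> with the fields \<open>W j\<close> built from a test field \<open>U\<close>. The integral of \<open>div (W j)\<close> over \<open>E\<close> is at least that of
  \<open>\<phi> j * div U\<close> up to an error \<open>C |E| / (j + 1)\<close>, and by dominated convergence the limit is the integral of \<open>div U\<close> over the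
  truncated set.
\<close>

lemma perimeter_half_space_le:
  assumes E: "E \<in> lmeasurable"
  shows "perimeter k X g K (E \<inter> {p. p $ Min UNIV < t}) \<le> perimeter k X g K E"
  unfolding perimeter_def[of k X g K "E \<inter> {p. p $ Min UNIV < t}"]
proof (rule Sup_least, clarify)
  fix U assume U: "test_field k X K U"
  let ?H = "{p :: (real, 'n) vec. p $ Min UNIV < t}"
  have Em: "E \<in> sets lebesgue" using E by auto
  obtain \<phi> :: "nat \<Rightarrow> (real, 'n) vec \<Rightarrow> real" and W :: "nat \<Rightarrow> (real, 'n) vec \<Rightarrow> (real, 'n) vec" and C
  where W: "\<And>j. test_field k X K (W j)" and \<phi>: "\<And>j. continuous_on UNIV (\<phi> j)"
    "\<And>j p. 0 \<le> \<phi> j p" "\<And>j p. \<phi> j p \<le> 1"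
    "\<And>p. (\<lambda>j. \<phi> j p) \<longlonglongrightarrow> indicator ?H p"
    and ev: "\<forall>\<^sub>F j in sequentially. \<forall>p. \<phi> j p * euclidean_divergence U p - C / real (Suc j) \<le> euclidean_divergence (W j) p"
    by (rule truncated_test_field[OF U, of t]) (rule that)
  have div: "divergence g Z = euclidean_divergence Z" if "test_field k X K Z" for Z
  proof
    fix p
    have "Ck 1 Z" using that unfolding test_field_def by blast
    then show "divergence g Z p = euclidean_divergence Z p" by (rule divergence_eq)
  qed
  have int: "integrable lebesgue (\<lambda>p. f p * euclidean_divergence Z p)"
    if "test_field k X K Z" "continuous_on UNIV f" for Z f
  proof -
    obtain S where S: "compact S" "\<And>p. p \<notin> S \<Longrightarrow> euclidean_divergence Z p = 0"
      using compactly_supported_divergence(2)[OF \<open>test_field k X K Z\<close>] by blast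
    then show ?thesis
      using compactly_supported_divergence(1)[OF \<open>test_field k X K Z\<close>] \<open>continuous_on UNIV f\<close>
      by (intro integrable_compact_support[of _ S] continuous_intros) auto
  qed
  have intE: "integrable lebesgue (\<lambda>p. indicator E p *\<^sub>R (f p * euclidean_divergence Z p))"
    if "test_field k X K Z" "continuous_on UNIV f" for Z f
    by (rule integrable_mult_indicator[OF _ int[OF that]]) (simp add: Em)
  have intE1: "integrable lebesgue (\<lambda>p. indicator E p *\<^sub>R euclidean_divergence Z p)"
    if "test_field k X K Z" for Z
    using intE[OF that, of "\<lambda>_. 1"] by simp
  have intE0: "integrable lebesgue (\<lambda>p. indicator E p *\<^sub>R x)" for x :: real
    using E by (intro integrable_scaleR_left integrable_real_indicator) (auto simp: fmeasurable_def)
  have lim1: "(\<lambda>j. LINT p|lebesgue. indicator E p *\<^sub>R (\<phi> j p * euclidean_divergence U p)) \<longlonglongrightarrow>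
      (LINT p|lebesgue. indicator (E \<inter> ?H) p *\<^sub>R euclidean_divergence U p)"
  proof (rule integral_dominated_convergence)
    show "integrable lebesgue (\<lambda>p. norm (indicator E p *\<^sub>R euclidean_divergence U p))"
      by (intro integrable_norm intE1 U)
    show "AE p in lebesgue. (\<lambda>j. indicator E p *\<^sub>R (\<phi> j p * euclidean_divergence U p)) \<longlonglongrightarrow>
        indicator (E \<inter> ?H) p *\<^sub>R euclidean_divergence U p"
    proof (rule AE_I2)
      fix p
      have "(\<lambda>j. indicator E p *\<^sub>R (\<phi> j p * euclidean_divergence U p)) \<longlonglongrightarrow>
        indicator E p *\<^sub>R (indicator ?H p * euclidean_divergence U p)"
        by (intro tendsto_intros \<phi>(4))
      then show "(\<lambda>j. indicator E p *\<^sub>R (\<phi> j p * euclidean_divergence U p)) \<longlonglongrightarrow>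
        indicator (E \<inter> ?H) p *\<^sub>R euclidean_divergence U p"
        by (simp add: indicator_inter_arith mult.assoc)
    qed
    show "AE p in lebesgue. norm (indicator E p *\<^sub>R (\<phi> j p * euclidean_divergence U p)) \<le>
        norm (indicator E p *\<^sub>R euclidean_divergence U p)" for j
    proof (rule AE_I2)
      fix p
      have "\<bar>\<phi> j p\<bar> * \<bar>euclidean_divergence U p\<bar> \<le> 1 * \<bar>euclidean_divergence U p\<bar>"
        using \<phi>(2,3)[of j p] by (intro mult_right_mono) simp_all
      then show "norm (indicator E p *\<^sub>R (\<phi> j p * euclidean_divergence U p)) \<le>
        norm (indicator E p *\<^sub>R euclidean_divergence U p)"
        by (simp add: abs_mult mult_left_mono)
    qed
    show "(\<lambda>p. indicator E p *\<^sub>R (\<phi> j p * euclidean_divergence U p)) \<in> borel_measurable lebesgue" for j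
      using intE[OF U \<phi>(1)] by (rule borel_measurable_integrable)
    have "integrable lebesgue (\<lambda>p. indicator ?H p *\<^sub>R (indicator E p *\<^sub>R euclidean_divergence U p))"
      by (rule integrable_mult_indicator[OF _ intE1[OF U]]) (simp add: half_space_measurable)
    moreover have "(\<lambda>p. indicator ?H p *\<^sub>R (indicator E p *\<^sub>R euclidean_divergence U p)) =
        (\<lambda>p. indicator (E \<inter> ?H) p *\<^sub>R euclidean_divergence U p)"
      by (auto simp: indicator_def)
    ultimately show "(\<lambda>p. indicator (E \<inter> ?H) p *\<^sub>R euclidean_divergence U p) \<in> borel_measurable lebesgue"
      by (simp only: borel_measurable_integrable)
  qed
  have lim2: "(\<lambda>j. (LINT p|lebesgue. indicator E p *\<^sub>R (\<phi> j p * euclidean_divergence U p)) -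
        measure lebesgue E * (C * (1 / real (Suc j)))) \<longlonglongrightarrow>
      (LINT p|lebesgue. indicator (E \<inter> ?H) p *\<^sub>R euclidean_divergence U p) - measure lebesgue E * (C * 0)"
    by (rule tendsto_diff[OF lim1 tendsto_mult[OF tendsto_const
            tendsto_mult[OF tendsto_const LIMSEQ_Suc[OF lim_1_over_n]]]])
  have "\<forall>\<^sub>F j in sequentially. ereal ((LINT p|lebesgue. indicator E p *\<^sub>R (\<phi> j p * euclidean_divergence U p)) -
        measure lebesgue E * (C * (1 / real (Suc j)))) \<le> perimeter k X g K E"
    using ev
  proof eventually_elim
    case (elim j)
    have "(LINT p|lebesgue. indicator E p *\<^sub>R (\<phi> j p * euclidean_divergence U p)) -
        measure lebesgue E * (C * (1 / real (Suc j))) =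
      (LINT p|lebesgue. indicator E p *\<^sub>R (\<phi> j p * euclidean_divergence U p) - indicator E p *\<^sub>R (C / real (Suc j)))"
      using E by (subst Bochner_Integration.integral_diff[OF intE[OF U \<phi>(1)] intE0]) (simp add: fmeasurable_def)
    also have "\<dots> \<le> (LINT p|lebesgue. indicator E p *\<^sub>R euclidean_divergence (W j) p)"
    proof (rule integral_mono)
      show "integrable lebesgue (\<lambda>p. indicator E p *\<^sub>R (\<phi> j p * euclidean_divergence U p) - indicator E p *\<^sub>R (C / real (Suc j)))"
        by (intro Bochner_Integration.integrable_diff intE U \<phi>(1) intE0)
      show "integrable lebesgue (\<lambda>p. indicator E p *\<^sub>R euclidean_divergence (W j) p)"
        by (rule intE1[OF W])
      show "indicator E p *\<^sub>R (\<phi> j p * euclidean_divergence U p) - indicator E p *\<^sub>R (C / real (Suc j)) \<le>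
        indicator E p *\<^sub>R euclidean_divergence (W j) p" for p
        using elim by (simp add: indicator_def)
    qed
    also have "\<dots> = (LINT p:E|lebesgue. divergence g (W j) p)"
      by (simp add: set_lebesgue_integral_def div[OF W])
    finally have "ereal ((LINT p|lebesgue. indicator E p *\<^sub>R (\<phi> j p * euclidean_divergence U p)) -
        measure lebesgue E * (C * (1 / real (Suc j)))) \<le> ereal (LINT p:E|lebesgue. divergence g (W j) p)"
      by simp
    also have "\<dots> \<le> perimeter k X g K E"
      unfolding perimeter_def by (rule Sup_upper) (use W in blast)
    finally show ?case .
  qed
  from tendsto_le[OF _ tendsto_const tendsto_ereal[OF lim2] this]
  show "ereal (LINT x:E \<inter> ?H|lebesgue. divergence g U x) \<le> perimeter k X g K E"
    by (simp add: set_lebesgue_integral_def div[OF U])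
qed

end

lemma measure_half_space_tendsto:
  fixes E :: "(real^'n) set" and t :: "nat \<Rightarrow> real"
  assumes E: "E \<in> lmeasurable" and F: "F \<in> sets lebesgue"
    and conv: "AE p in lebesgue. (\<lambda>m. indicator {p. p $ i < t m} p :: real) \<longlonglongrightarrow> indicator F p"
  shows "(\<lambda>m. measure lebesgue (E \<inter> {p. p $ i < t m})) \<longlonglongrightarrow> measure lebesgue (E \<inter> F)"
proof -
  have H: "{p :: real^'n. p $ i < x} \<in> sets lebesgue" for x
    by (rule half_space_measurable)
  have Em: "E \<in> sets lebesgue" using E by auto
  have "(\<lambda>m. LINT p|lebesgue. indicator (E \<inter> {p. p $ i < t m}) p :: real) \<longlonglongrightarrow>
    (LINT p|lebesgue. indicator (E \<inter> F) p)"
  proof (rule integral_dominated_convergence)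
    show "integrable lebesgue (indicator E :: _ \<Rightarrow> real)"
      using E by (intro integrable_real_indicator) (auto simp: fmeasurable_def)
    show "AE p in lebesgue. (\<lambda>m. indicator (E \<inter> {p. p $ i < t m}) p :: real) \<longlonglongrightarrow> indicator (E \<inter> F) p"
      using conv by eventually_elim (auto simp: indicator_inter_arith intro!: tendsto_mult)
    show "AE p in lebesgue. norm (indicator (E \<inter> {p. p $ i < t m}) p :: real) \<le> indicator E p" for m
      by (auto simp: indicator_def)
    show "(\<lambda>p. indicator (E \<inter> {p. p $ i < t m}) p :: real) \<in> borel_measurable lebesgue" for m
      by (intro borel_measurable_indicator sets.Int Em H)
    show "(\<lambda>p. indicator (E \<inter> F) p :: real) \<in> borel_measurable lebesgue"
      by (intro borel_measurable_indicator sets.Int Em F)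
  qed
  then show ?thesis using Em F H by simp
qed

text \<open>
  Hyperplanes are null sets, so the volume of the truncated set is continuous in \<open>t\<close>; it tends to \<open>0\<close> and to \<open>|E|\<close> at
  the two ends, and the intermediate value theorem applies.
\<close>

lemma half_space_of_measure:
  fixes E :: "(real^'n) set"
  assumes E: "E \<in> lmeasurable" and w: "0 < w" "w < measure lebesgue E"
  obtains t where "measure lebesgue (E \<inter> {p. p $ i < t}) = w"
proof -
  define m where "m t = measure lebesgue (E \<inter> {p. p $ i < t})" for t
  have "(m \<longlongrightarrow> m t) (at t)" for t
    unfolding tendsto_at_iff_sequentially o_def m_def
  proof (intro allI impI measure_half_space_tendsto E)
    fix \<tau> :: "nat \<Rightarrow> real" assume \<tau>: "\<tau> \<longlonglongrightarrow> t"
    show "{p :: real^'n. p $ i < t} \<in> sets lebesgue"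
      by (rule half_space_measurable)
    have "negligible {p :: real^'n. p $ i = t}"
      using negligible_standard_hyperplane[of "axis i 1 :: real^'n" t] by (simp add: inner_axis)
    then have "AE p in lebesgue. p \<notin> {p :: real^'n. p $ i = t}"
      by (intro AE_not_in) (simp add: negligible_iff_null_sets)
    then show "AE p :: real^'n in lebesgue. (\<lambda>j. indicator {p. p $ i < \<tau> j} p :: real) \<longlonglongrightarrow> indicator {p. p $ i < t} p"
    proof eventually_elim
      case (elim p)
      show ?case
      proof (cases "p $ i < t")
        case True
        have "\<forall>\<^sub>F j in sequentially. p $ i < \<tau> j" using order_tendstoD(1)[OF \<tau> True] .
        then have "\<forall>\<^sub>F j in sequentially. (indicator {p. p $ i < \<tau> j} p :: real) = 1"
          by eventually_elim simp
        then show ?thesis using True by (simp add: tendsto_eventually)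
      next
        case False
        then have "t < p $ i" using elim by simp
        then have "\<forall>\<^sub>F j in sequentially. \<tau> j < p $ i" using order_tendstoD(2)[OF \<tau>] by blast
        then have "\<forall>\<^sub>F j in sequentially. (indicator {p. p $ i < \<tau> j} p :: real) = 0"
          by eventually_elim simp
        then show ?thesis using False by (simp add: tendsto_eventually)
      qed
    qed
  qed
  then have cont: "continuous_on S m" for S
    by (intro continuous_at_imp_continuous_on) (simp add: isCont_def)
  have "(\<lambda>j. m (real j)) \<longlonglongrightarrow> measure lebesgue (E \<inter> UNIV)"
    unfolding m_def
  proof (rule measure_half_space_tendsto[OF E _ AE_I2])
    fix p :: "real^'n"
    have "\<forall>\<^sub>F j in sequentially. p $ i < real j"
      using eventually_gt_at_top[of "nat \<lceil>p $ i\<rceil>"] by eventually_elim linarith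
    then have "\<forall>\<^sub>F j in sequentially. (indicator {p. p $ i < real j} p :: real) = 1"
      by eventually_elim simp
    then show "(\<lambda>j. indicator {p. p $ i < real j} p :: real) \<longlonglongrightarrow> indicator UNIV p"
      by (simp add: tendsto_eventually)
  qed simp
  then have "\<forall>\<^sub>F j in sequentially. w < m (real j)" using w by (intro order_tendstoD(1)) auto
  then obtain j1 where j1: "w < m (real j1)" by (auto simp: eventually_sequentially)
  have "(\<lambda>j. m (- real j)) \<longlonglongrightarrow> measure lebesgue (E \<inter> {})"
    unfolding m_def
  proof (rule measure_half_space_tendsto[OF E _ AE_I2])
    fix p :: "real^'n"
    have "\<forall>\<^sub>F j in sequentially. \<not> p $ i < - real j"
      using eventually_gt_at_top[of "nat \<lceil>- p $ i\<rceil>"] by eventually_elim linarith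
    then have "\<forall>\<^sub>F j in sequentially. (indicator {p. p $ i < - real j} p :: real) = 0"
      by eventually_elim simp
    then show "(\<lambda>j. indicator {p. p $ i < - real j} p :: real) \<longlonglongrightarrow> indicator {} p"
      by (simp add: tendsto_eventually)
  qed simp
  then have "\<forall>\<^sub>F j in sequentially. m (- real j) < w" using w by (intro order_tendstoD(2)) auto
  then obtain j0 where j0: "m (- real j0) < w" by (auto simp: eventually_sequentially)
  have "\<exists>t. - real j0 \<le> t \<and> t \<le> real j1 \<and> m t = w"
    using j0 j1 by (intro IVT' cont) simp_all
  then show ?thesis using that by (auto simp: m_def)
qed

theorem proposition3p1:
  fixes mul :: "real^'n::{finite,linorder} \<Rightarrow> real^'n::{finite,linorder} \<Rightarrow> real^'n::{finite,linorder}"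
    and inv :: "real^'n::{finite,linorder} \<Rightarrow> real^'n::{finite,linorder}"
    and r k :: nat
    and X :: "nat \<Rightarrow> real^'n::{finite,linorder} \<Rightarrow> real^'n::{finite,linorder}"
    and V :: "real^'n::{finite,linorder} \<Rightarrow> (real^'n::{finite,linorder}) set"
    and g :: "real^'n::{finite,linorder} \<Rightarrow> real^'n::{finite,linorder} \<Rightarrow> real^'n::{finite,linorder} \<Rightarrow> real"
    and K :: "(real^'n::{finite,linorder}) set"
    and v w :: real
  assumes "sub_finsler_nilpotent_group mul inv r k X V g K"
    and "0 < w" and "w \<le> v"
  shows "isoperimetric_profile k X g K w \<le> isoperimetric_profile k X g K v"
proof -
  interpret sub_finsler_nilpotent_group mul inv r k X V g K by (rule assms(1))
  show ?thesis
    unfolding isoperimetric_profile_def[of k X g K v]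
  proof (rule Inf_greatest, clarify)
    fix E assume E: "finite_perimeter k X g K E" "emeasure lebesgue E = ennreal v"
    have v: "0 < v" using assms by simp
    have Em: "E \<in> lmeasurable" "measure lebesgue E = v"
      using E v by (auto simp: finite_perimeter_def fmeasurable_def measure_def)
    show "isoperimetric_profile k X g K w \<le> perimeter k X g K E"
    proof (cases "w = v")
      case True
      then show ?thesis
        unfolding isoperimetric_profile_def using E by (intro Inf_lower) auto
    next
      case False
      then have "w < measure lebesgue E" using assms Em by simp
      then obtain t where t: "measure lebesgue (E \<inter> {p. p $ Min UNIV < t}) = w"
        using half_space_of_measure[OF Em(1) assms(2)] by metis
      let ?F = "E \<inter> {p. p $ Min UNIV < t}"
      have F: "?F \<in> lmeasurable"
        by (intro fmeasurable_Int_fmeasurable Em(1) half_space_measurable)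
      have P: "perimeter k X g K ?F \<le> perimeter k X g K E"
        by (rule perimeter_half_space_le[OF Em(1)])
      have "finite_perimeter k X g K ?F"
        using E(1) P F by (auto simp: finite_perimeter_def intro: le_less_trans)
      moreover have "emeasure lebesgue ?F = ennreal w"
        using emeasure_eq_measure2[OF F] t by simp
      ultimately have "isoperimetric_profile k X g K w \<le> perimeter k X g K ?F"
        unfolding isoperimetric_profile_def by (intro Inf_lower) blast
      then show ?thesis using P by (rule order_trans)
    qed
  qed
qed

end
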